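(* Let $d\ge1$, $r_1,\dots,r_d\in\mathbb{Z}$, and let $(U_n)_{n\ge0}$ be a sequence of integers with $U_n=r_1U_{n-1}+\cdots+r_dU_{n-d}$ for all $n\ge d$, whose characteristic polynomial $C(x)=x^d-r_1x^{d-1}-\cdots-r_d$ is irreducible over $\mathbb{Q}$. Let $\alpha_0,\dots,\alpha_{d-1}$ be the roots of $C$ and $l_0,\dots,l_{d-1}$ the constants with $U_n=\sum_{i=0}^{d-1}l_i\alpha_i^n$ for all $n\ge0$. Then $(U_n)_{n\ge1}$ almost satisfies the Dold condition if and only if $l_0=l_1=\cdots=l_{d-1}$.
   Context: A sequence of integers $(A_n)_{n\ge1}$ satisfies the Dold condition if $n\mid\sum_{d\mid n}\mu(d)A_{n/d}$ for every $n\in\mathbb{N}_+$ ($\mu$ the Möbius function). It almost satisfies the Dold condition if there is $c\in\mathbb{N}_+$ such that $(cA_n)_{n\ge1}$ satisfies the Dold condition. *)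

theory Defs
  imports Complex_Main "HOL-Computational_Algebra.Computational_Algebra"
begin

definition moebius_mu :: "nat \<Rightarrow> int" where
  "moebius_mu n = (if squarefree n then (-1) ^ card (prime_factors n) else 0)"

(* Sequences are indexed from 1: the value A 0 does not enter the condition. *)
definition dold_condition :: "(nat \<Rightarrow> int) \<Rightarrow> bool" where
  "dold_condition A \<longleftrightarrow>
     (\<forall>n>0. int n dvd (\<Sum>d | d dvd n. moebius_mu d * A (n div d)))"

definition almost_dold_condition :: "(nat \<Rightarrow> int) \<Rightarrow> bool" where
  "almost_dold_condition A \<longleftrightarrow>
     (\<exists>c::nat. c > 0 \<and> dold_condition (\<lambda>n. int c * A n))"

(* x^d - r_1 x^(d-1) - ... - r_d; only r 1, ..., r d are used. *)
definition rec_char_poly :: "nat \<Rightarrow> (nat \<Rightarrow> int) \<Rightarrow> int poly" where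
  "rec_char_poly d r = monom 1 d - (\<Sum>i=1..d. monom (r i) (d - i))"

end

theory Submission
  imports Defs "Jordan_Normal_Form.Char_Poly" "HOL-Number_Theory.Number_Theory"
begin

text \<open>
  If all \<open>l i\<close> agree, then \<open>d * U n = U 0 * T n\<close> with the power sums \<open>T n = (\<Sum>i<d. \<alpha> i ^ n)\<close>. The power
  series \<open>\<Prod>i<d. 1 - \<alpha> i X\<close> has integer coefficients and constant term \<open>1\<close>, so it is an infinite product
  of integer powers \<open>(1 - X ^ k) powi b k\<close>; comparing logarithmic derivatives gives
  \<open>T n = (\<Sum>k | k dvd n. k * b k)\<close>, and Moebius inversion yields the Dold condition.

  Conversely, after scaling by an integer the \<open>l i\<close> are conjugate algebraic integers. The Dold condition
  gives \<open>p dvd c * (U (p * m) - U m)\<close>, and a Vandermonde argument turns this into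
  \<open>l i ^ p \<equiv> l i\<close> modulo \<open>p\<close> for almost all primes \<open>p\<close>. If the \<open>l i\<close> were not all equal, their minimal
  polynomial \<open>f\<close>, of degree \<open>k \<ge> 2\<close>, would have two distinct roots modulo almost every \<open>p\<close>. Chebotarev's
  theorem would exclude this, but counting suffices: given a root \<open>t\<close> of \<open>f\<close> modulo a squarefree \<open>n\<close>, the
  pigeonhole principle provides an element of \<open>\<int>[\<beta>]\<close> with coordinates of size at most \<open>n powr (1 / k)\<close>
  that vanishes at \<open>t\<close> modulo \<open>n\<close>, and whose norm is therefore a bounded multiple of \<open>n\<close>. This makes the
  number of pairs \<open>(n, t)\<close> with \<open>n \<le> x\<close> at most \<open>O(x)\<close>, whereas two roots modulo each prime force it to
  exceed every multiple of \<open>x\<close>, because the sum of the reciprocals of the primes diverges.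
\<close>

hide_const (open) Module.smult up_ring.monom up_ring.coeff Coset.order

unbundle no fps_syntax

section \<open>Integer polynomials evaluated at complex numbers\<close>

abbreviation cpoly :: "int poly \<Rightarrow> complex \<Rightarrow> complex" where
  "cpoly p \<equiv> poly (map_poly of_int p)"

lemma cpoly_add: "cpoly (p + q) x = cpoly p x + cpoly q x"
  by (simp add: of_int_poly_hom.hom_add)

lemma cpoly_diff: "cpoly (p - q) x = cpoly p x - cpoly q x"
  by (simp add: of_int_poly_hom.hom_minus)

lemma cpoly_mult: "cpoly (p * q) x = cpoly p x * cpoly q x"
  by (simp add: of_int_poly_hom.hom_mult)

lemma cpoly_sum: "cpoly (sum p A) x = (\<Sum>a\<in>A. cpoly (p a) x)"
  by (simp add: of_int_poly_hom.hom_sum poly_sum)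

lemma cpoly_smult: "cpoly (Polynomial.smult c p) x = of_int c * cpoly p x"
  by (simp add: of_int_hom.map_poly_hom_smult)

lemma cpoly_pCons: "cpoly (pCons a p) x = of_int a + x * cpoly p x"
  by (simp add: of_int_hom.map_poly_pCons_hom)

lemma cpoly_altdef: "cpoly p x = (\<Sum>i\<le>degree p. of_int (coeff p i) * x ^ i)"
  by (simp add: poly_altdef coeff_map_poly degree_map_poly)

section \<open>The ring of algebraic integers\<close>

text \<open>The subgroup generated by a finite \<open>E\<close>. Indexing the coefficients by the
  elements themselves avoids an enumeration of \<open>E\<close>.\<close>

definition int_span :: "complex set \<Rightarrow> complex set" where
  "int_span E = {\<Sum>e\<in>E. of_int (c e) * e | c. True}"

lemma int_span_add: "x \<in> int_span E \<Longrightarrow> y \<in> int_span E \<Longrightarrow> x + y \<in> int_span E"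
  unfolding int_span_def
proof safe
  fix c d :: "complex \<Rightarrow> int"
  show "\<exists>b. (\<Sum>e\<in>E. of_int (c e) * e) + (\<Sum>e\<in>E. of_int (d e) * e) = (\<Sum>e\<in>E. of_int (b e) * e) \<and> True"
    by (rule exI[of _ "\<lambda>e. c e + d e"]) (simp add: sum.distrib algebra_simps)
qed

lemma int_span_cmult: "x \<in> int_span E \<Longrightarrow> of_int a * x \<in> int_span E"
  unfolding int_span_def
proof safe
  fix c :: "complex \<Rightarrow> int"
  show "\<exists>b. of_int a * (\<Sum>e\<in>E. of_int (c e) * e) = (\<Sum>e\<in>E. of_int (b e) * e) \<and> True"
    by (rule exI[of _ "\<lambda>e. a * c e"]) (simp add: sum_distrib_left mult.assoc)
qed

lemma int_span_0: "0 \<in> int_span E"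
  unfolding int_span_def by (rule CollectI, rule exI[of _ "\<lambda>_. 0"]) simp

lemma int_span_sum: "(\<And>i. i \<in> A \<Longrightarrow> g i \<in> int_span E) \<Longrightarrow> sum g A \<in> int_span E"
  by (induction A rule: infinite_finite_induct) (auto intro: int_span_add int_span_0)

lemma int_span_base:
  assumes "finite E" "x \<in> E" shows "x \<in> int_span E"
  unfolding int_span_def
  by (rule CollectI, rule exI[of _ "\<lambda>e. if e = x then 1 else 0"])
     (use assms in \<open>simp add: if_distrib if_distribR cong: if_cong\<close>)

lemma int_span_mult_closed:
  assumes "\<And>e. e \<in> E \<Longrightarrow> z * e \<in> int_span E" "x \<in> int_span E"
  shows "z * x \<in> int_span E"
proof -
  obtain c where "x = (\<Sum>e\<in>E. of_int (c e) * e)"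
    using assms(2) by (auto simp: int_span_def)
  hence "z * x = (\<Sum>e\<in>E. of_int (c e) * (z * e))"
    by (simp add: sum_distrib_left mult_ac)
  thus ?thesis using assms(1) by (auto intro!: int_span_sum int_span_cmult)
qed

text \<open>Determinant trick: multiplication by \<open>z\<close> on the generators is given by an
  integer matrix \<open>M\<close>. The vector of the generators is an eigenvector, nonzero because
  it contains 1, so \<open>z\<close> is a root of the monic integral characteristic
  polynomial.\<close>

lemma algebraic_int_if_stable_module:
  fixes E :: "complex set"
  assumes fin: "finite E" and "1 \<in> E" and stable: "\<And>e. e \<in> E \<Longrightarrow> z * e \<in> int_span E"
  shows "algebraic_int z"
proof -
  define N where "N = card E"
  obtain b where b: "bij_betw b {0..<N} E"
    unfolding N_def using ex_bij_betw_nat_finite[OF fin] by blast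
  obtain c where c: "\<And>e. e \<in> E \<Longrightarrow> z * e = (\<Sum>e'\<in>E. of_int (c e e') * e')"
    using stable unfolding int_span_def by simp metis
  define M :: "int mat" where "M = mat N N (\<lambda>(i, j). c (b i) (b j))"
  define v :: "complex vec" where "v = vec N b"
  let ?M = "map_mat of_int M :: complex mat"
  have M: "M \<in> carrier_mat N N" and M': "?M \<in> carrier_mat N N" by (auto simp: M_def)
  have "?M *\<^sub>v v = z \<cdot>\<^sub>v v"
  proof (rule eq_vecI)
    fix i assume "i < dim_vec (z \<cdot>\<^sub>v v)"
    hence i: "i < N" by (simp add: v_def)
    hence "b i \<in> E" using b by (auto simp: bij_betw_def)
    hence "z * b i = (\<Sum>e'\<in>E. of_int (c (b i) e') * e')" by (rule c)
    also have "\<dots> = (\<Sum>j\<in>{0..<N}. of_int (c (b i) (b j)) * b j)"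
      by (rule sum.reindex_bij_betw[OF b, symmetric])
    finally show "(?M *\<^sub>v v) $ i = (z \<cdot>\<^sub>v v) $ i"
      using i by (simp add: M_def v_def scalar_prod_def)
  qed (simp add: v_def M_def)
  moreover obtain k where "k < N" "b k = 1"
    using b \<open>1 \<in> E\<close> unfolding bij_betw_def by (metis atLeastLessThan_iff image_iff)
  hence "v \<noteq> 0\<^sub>v N" by (metis index_vec index_zero_vec(1) v_def zero_neq_one)
  ultimately have "eigenvalue ?M z"
    unfolding eigenvalue_def eigenvector_def using M' by (intro exI[of _ v]) (auto simp: v_def M_def)
  hence "poly (char_poly ?M) z = 0"
    using eigenvalue_root_char_poly[OF M'] by simp
  hence "cpoly (char_poly M) z = 0"
    by (simp add: of_int_hom.char_poly_hom[OF M])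
  moreover have "lead_coeff (char_poly M) = 1"
    using degree_monic_char_poly[OF M] by simp
  ultimately show ?thesis
    unfolding algebraic_int_altdef_ipoly by blast
qed

text \<open>The monomials \<open>x ^ i * y ^ j\<close> below the degrees of monic equations for
  \<open>x\<close> and \<open>y\<close> generate a module stable under both numbers, hence under
  their sum and product.\<close>

lemma algebraic_int_common_module:
  assumes "algebraic_int (x::complex)" "algebraic_int y"
  obtains E where "finite E" "1 \<in> E"
    "\<And>e. e \<in> E \<Longrightarrow> x * e \<in> int_span E" "\<And>e. e \<in> E \<Longrightarrow> y * e \<in> int_span E"
proof -
  obtain p q where p: "cpoly p x = 0" "lead_coeff p = 1" and q: "cpoly q y = 0" "lead_coeff q = 1"
    using assms unfolding algebraic_int_altdef_ipoly by blast
  have pos: "degree r > 0" if "cpoly r w = 0" "lead_coeff r = 1" for r w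
    using that by (intro Nat.gr0I) (auto elim!: degree_eq_zeroE)
  \<comment> \<open>A monic equation is solved for its top power, which brings exponents that leave
    the range back into it.\<close>
  have red: "w ^ degree r = (\<Sum>i<degree r. of_int (- coeff r i) * w ^ i)"
    if "cpoly r w = 0" "lead_coeff r = 1" for r and w :: complex
  proof -
    have "0 = (\<Sum>i\<le>degree r. of_int (coeff r i) * w ^ i)"
      using that(1) by (simp add: cpoly_altdef)
    also have "{..degree r} = insert (degree r) {..<degree r}" by auto
    also have "(\<Sum>i\<in>\<dots>. of_int (coeff r i) * w ^ i) = w ^ degree r + (\<Sum>i<degree r. of_int (coeff r i) * w ^ i)"
      using that(2) by (subst sum.insert) auto
    finally show ?thesis by (simp add: sum_negf add_eq_0_iff)
  qed
  define E where "E = (\<lambda>(i, j). x ^ i * y ^ j) ` ({..<degree p} \<times> {..<degree q})"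
  have fin: "finite E" by (simp add: E_def)
  have base: "x ^ i * y ^ j \<in> int_span E" if "i < degree p" "j < degree q" for i j
    by (rule int_span_base[OF fin]) (use that in \<open>auto simp: E_def\<close>)
  show ?thesis
  proof (rule that[OF fin])
    show "1 \<in> E" unfolding E_def using pos[OF p] pos[OF q]
      by (auto intro!: image_eqI[of _ _ "(0, 0)"])
  next
    fix e assume "e \<in> E"
    then obtain i j where ij: "i < degree p" "j < degree q" "e = x ^ i * y ^ j" by (auto simp: E_def)
    show "x * e \<in> int_span E"
    proof (cases "Suc i < degree p")
      case True thus ?thesis using base[of "Suc i" j] ij by (simp add: mult_ac)
    next
      case False
      hence "Suc i = degree p" using ij by simp
      hence "x * e = x ^ degree p * y ^ j" using ij by (metis mult.assoc power_Suc)
      also have "\<dots> = (\<Sum>i<degree p. of_int (- coeff p i) * (x ^ i * y ^ j))"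
        unfolding red[OF p] by (simp add: sum_distrib_right mult.assoc)
      also have "\<dots> \<in> int_span E" by (intro int_span_sum int_span_cmult base) (use ij in auto)
      finally show ?thesis .
    qed
    show "y * e \<in> int_span E"
    proof (cases "Suc j < degree q")
      case True thus ?thesis using base[of i "Suc j"] ij by (simp add: mult_ac)
    next
      case False
      hence "Suc j = degree q" using ij by simp
      hence "y * e = y ^ degree q * x ^ i" using ij by (metis mult.assoc mult.commute power_Suc)
      also have "\<dots> = (\<Sum>j<degree q. of_int (- coeff q j) * (x ^ i * y ^ j))"
        unfolding red[OF q] by (simp add: sum_distrib_right sum_distrib_left mult_ac)
      also have "\<dots> \<in> int_span E" by (intro int_span_sum int_span_cmult base) (use ij in auto)
      finally show ?thesis .
    qed
  qed
qed

lemma algebraic_int_add [intro]: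
  assumes "algebraic_int (x::complex)" "algebraic_int y" shows "algebraic_int (x + y)"
proof -
  obtain E where E: "finite E" "1 \<in> E"
    "\<And>e. e \<in> E \<Longrightarrow> x * e \<in> int_span E" "\<And>e. e \<in> E \<Longrightarrow> y * e \<in> int_span E"
    using algebraic_int_common_module[OF assms] by blast
  show ?thesis
    by (rule algebraic_int_if_stable_module[OF E(1,2)]) (auto simp: distrib_right intro: int_span_add E)
qed

lemma algebraic_int_mult [intro]:
  assumes "algebraic_int (x::complex)" "algebraic_int y" shows "algebraic_int (x * y)"
proof -
  obtain E where E: "finite E" "1 \<in> E"
    "\<And>e. e \<in> E \<Longrightarrow> x * e \<in> int_span E" "\<And>e. e \<in> E \<Longrightarrow> y * e \<in> int_span E"
    using algebraic_int_common_module[OF assms] by blast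
  show ?thesis
    by (rule algebraic_int_if_stable_module[OF E(1,2)])
       (auto simp: mult.assoc intro: int_span_mult_closed E)
qed

lemma algebraic_int_of_int [simp, intro]: "algebraic_int (of_int n :: complex)"
  by (rule int_imp_algebraic_int) auto

lemma algebraic_int_of_nat [simp, intro]: "algebraic_int (of_nat n :: complex)"
  by (rule int_imp_algebraic_int) auto

lemma algebraic_int_one [simp, intro]: "algebraic_int (1 :: complex)"
  by (rule int_imp_algebraic_int) auto

lemma algebraic_int_diff [intro]:
  "algebraic_int (x::complex) \<Longrightarrow> algebraic_int y \<Longrightarrow> algebraic_int (x - y)"
  using algebraic_int_add[of x "-y"] by auto

lemma algebraic_int_pow [intro]: "algebraic_int (x::complex) \<Longrightarrow> algebraic_int (x ^ n)"
  by (induction n) auto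

lemma algebraic_int_sum [intro]:
  "(\<And>i. i \<in> A \<Longrightarrow> algebraic_int (f i :: complex)) \<Longrightarrow> algebraic_int (sum f A)"
  by (induction A rule: infinite_finite_induct) auto

lemma algebraic_int_prod [intro]:
  "(\<And>i. i \<in> A \<Longrightarrow> algebraic_int (f i :: complex)) \<Longrightarrow> algebraic_int (prod f A)"
  by (induction A rule: infinite_finite_induct) auto

lemma algebraic_int_cpoly [intro]: "algebraic_int x \<Longrightarrow> algebraic_int (cpoly p x)"
  unfolding cpoly_altdef by auto

lemma algebraic_int_coeff_prod_linear:
  assumes "finite A" "\<And>a. a \<in> A \<Longrightarrow> algebraic_int (y a :: complex)"
  shows "algebraic_int (coeff (\<Prod>a\<in>A. [:- y a, 1:]) n)"
  using assms
proof (induction A arbitrary: n rule: finite_induct)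
  case empty
  show ?case by (simp add: coeff_1)
next
  case (insert a A)
  show ?case unfolding prod.insert[OF insert(1,2)]
    using insert.IH insert.prems
    by (cases n) (auto simp: mult_pCons_left coeff_pCons)
qed

text \<open>Congruence modulo \<open>p\<close> in the ring of all algebraic integers, so that
  neither a number field nor a prime ideal above \<open>p\<close> has to be chosen. Only the
  quotient of the difference by \<open>p\<close> must be integral.\<close>

definition alg_cong :: "nat \<Rightarrow> complex \<Rightarrow> complex \<Rightarrow> bool" where
  "alg_cong p x y \<longleftrightarrow> (\<exists>z. algebraic_int z \<and> x - y = of_nat p * z)"

lemma alg_cong_refl [simp]: "alg_cong p x x"
  unfolding alg_cong_def by (rule exI[of _ 0]) auto

lemma alg_cong_sym: "alg_cong p x y \<Longrightarrow> alg_cong p y x"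
  unfolding alg_cong_def
proof safe
  fix z assume "algebraic_int z" "x - y = of_nat p * z"
  thus "\<exists>z. algebraic_int z \<and> y - x = of_nat p * z"
    by (intro exI[of _ "-z"]) (auto simp: algebra_simps)
qed

lemma alg_cong_add: "alg_cong p x y \<Longrightarrow> alg_cong p x' y' \<Longrightarrow> alg_cong p (x + x') (y + y')"
  unfolding alg_cong_def
proof safe
  fix z z' assume "algebraic_int z" "x - y = of_nat p * z" "algebraic_int z'" "x' - y' = of_nat p * z'"
  thus "\<exists>z. algebraic_int z \<and> x + x' - (y + y') = of_nat p * z"
    by (intro exI[of _ "z + z'"]) (auto simp: algebra_simps)
qed

lemma alg_cong_trans [trans]: "alg_cong p x y \<Longrightarrow> alg_cong p y z \<Longrightarrow> alg_cong p x z"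
  using alg_cong_add[of p x y y z] by (auto simp: alg_cong_def algebra_simps)

lemma alg_cong_mult_left: "algebraic_int a \<Longrightarrow> alg_cong p x y \<Longrightarrow> alg_cong p (a * x) (a * y)"
  unfolding alg_cong_def
proof safe
  fix z assume "algebraic_int a" "algebraic_int z" "x - y = of_nat p * z"
  thus "\<exists>z. algebraic_int z \<and> a * x - a * y = of_nat p * z"
    by (intro exI[of _ "a * z"]) (auto simp: algebra_simps simp flip: right_diff_distrib)
qed

lemma alg_cong_mult:
  assumes "algebraic_int x" "algebraic_int y'" "alg_cong p x y" "alg_cong p x' y'"
  shows "alg_cong p (x * x') (y * y')"
proof -
  have "alg_cong p (x * x') (x * y')" using assms by (intro alg_cong_mult_left)
  also have "alg_cong p (x * y') (y * y')"
    using alg_cong_mult_left[OF assms(2,3)] by (simp add: mult.commute)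
  finally show ?thesis .
qed

lemma alg_cong_diff: "alg_cong p x y \<Longrightarrow> alg_cong p x' y' \<Longrightarrow> alg_cong p (x - x') (y - y')"
  using alg_cong_add[of p x y "-x'" "-y'"] alg_cong_mult_left[of "-1" p x' y'] by auto

lemma alg_cong_sum: "(\<And>i. i \<in> A \<Longrightarrow> alg_cong p (f i) (g i)) \<Longrightarrow> alg_cong p (sum f A) (sum g A)"
  by (induction A rule: infinite_finite_induct) (auto intro: alg_cong_add)

lemma alg_cong_prod:
  assumes "\<And>i. i \<in> A \<Longrightarrow> alg_cong p (f i) (g i)"
    "\<And>i. i \<in> A \<Longrightarrow> algebraic_int (f i)" "\<And>i. i \<in> A \<Longrightarrow> algebraic_int (g i)"
  shows "alg_cong p (prod f A) (prod g A)"
  using assms by (induction A rule: infinite_finite_induct) (auto intro!: alg_cong_mult)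

lemma alg_cong_0_iff_diff: "alg_cong p x y \<longleftrightarrow> alg_cong p (x - y) 0"
  by (simp add: alg_cong_def)

lemma alg_cong_of_int:
  assumes "int p dvd a - b" shows "alg_cong p (of_int a) (of_int b)"
proof -
  obtain k where "a - b = int p * k" using assms by (auto simp: dvd_def)
  thus ?thesis unfolding alg_cong_def
    by (intro exI[of _ "of_int k"]) (metis algebraic_int_of_int of_int_diff of_int_mult of_int_of_nat_eq)
qed

text \<open>The quotient \<open>a / p\<close> is rational and an algebraic integer, hence an
  integer: passing to the larger ring creates no new congruences between integers.\<close>

lemma alg_cong_of_intD:
  assumes "alg_cong p (of_int a) 0" "p > 0" shows "int p dvd a"
proof -
  obtain z :: complex where z: "algebraic_int z" "of_int a = of_nat p * z" using assms by (auto simp: alg_cong_def)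
  hence "z = of_int a / of_int (int p)" using assms(2) by (simp add: field_simps)
  hence "z \<in> \<rat>" by auto
  with z(1) have "z \<in> \<int>" by (rule rational_algebraic_int_is_int)
  then obtain k where "z = of_int k" by (auto elim: Ints_cases)
  with z(2) have "(of_int a :: complex) = of_int (int p * k)" by simp
  hence "a = int p * k" by (simp only: of_int_eq_iff)
  thus ?thesis by simp
qed

text \<open>A Bezout relation \<open>u * a + v * int p = 1\<close> makes \<open>a\<close> invertible
  modulo \<open>p\<close>.\<close>

lemma alg_cong_0_cancel_int:
  assumes "alg_cong p (of_int a * x) 0" "coprime a (int p)" "algebraic_int x"
  shows "alg_cong p x 0"
proof -
  obtain u v where uv: "u * a + v * int p = 1" using assms(2) by (metis bezout_int coprime_imp_gcd_eq_1)
  have eq: "(of_int u * of_int a + of_int v * of_nat p :: complex) = 1"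
    using arg_cong[OF uv, of "of_int :: int \<Rightarrow> complex"] by simp
  have "alg_cong p (of_int u * (of_int a * x)) (of_int u * 0)"
    by (intro alg_cong_mult_left assms(1)) auto
  moreover have "alg_cong p (of_nat p * (of_int v * x)) 0"
    unfolding alg_cong_def using assms(3) by (intro exI[of _ "of_int v * x"]) auto
  ultimately have "alg_cong p (of_int u * (of_int a * x) + of_nat p * (of_int v * x)) 0"
    using alg_cong_add[of p _ 0 _ 0] by simp
  also have "of_int u * (of_int a * x) + of_nat p * (of_int v * x) = 
      (of_int u * of_int a + of_int v * of_nat p) * x" by (simp add: algebra_simps)
  finally show ?thesis using eq by simp
qed

text \<open>All binomial coefficients except the two outer ones are divisible by
  \<open>p\<close>.\<close>

lemma alg_cong_add_power_prime:
  assumes "prime p" "algebraic_int x" "algebraic_int y"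
  shows "alg_cong p ((x + y) ^ p) (x ^ p + y ^ p)"
proof -
  have "p > 0" using assms(1) prime_gt_0_nat by blast
  have "(x + y) ^ p = (\<Sum>k\<le>p. of_nat (p choose k) * x ^ k * y ^ (p - k))"
    by (simp add: binomial_ring)
  also have "{..p} = insert 0 (insert p {0<..<p})" by auto
  also have "(\<Sum>k\<in>\<dots>. of_nat (p choose k) * x ^ k * y ^ (p - k)) =
      x ^ p + y ^ p + (\<Sum>k\<in>{0<..<p}. of_nat (p choose k) * x ^ k * y ^ (p - k))"
    using \<open>p > 0\<close> by (simp add: algebra_simps)
  also have "alg_cong p \<dots> (x ^ p + y ^ p + (\<Sum>k\<in>{0<..<p}. 0))"
  proof (intro alg_cong_add alg_cong_refl alg_cong_sum)
    fix k assume "k \<in> {0<..<p}"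
    hence "p dvd (p choose k)" using assms(1) by (intro dvd_choose_prime) auto
    then obtain m where "p choose k = p * m" by blast
    thus "alg_cong p (of_nat (p choose k) * x ^ k * y ^ (p - k)) 0"
      unfolding alg_cong_def using assms by (intro exI[of _ "of_nat m * x ^ k * y ^ (p - k)"]) auto
  qed
  finally show ?thesis by simp
qed

lemma alg_cong_sum_power_prime:
  assumes "prime p" "\<And>i. i \<in> A \<Longrightarrow> algebraic_int (f i)"
  shows "alg_cong p ((\<Sum>i\<in>A. f i) ^ p) (\<Sum>i\<in>A. f i ^ p)"
  using assms(2)
proof (induction A rule: infinite_finite_induct)
  case (insert a A)
  have "alg_cong p ((f a + sum f A) ^ p) (f a ^ p + sum f A ^ p)"
    by (intro alg_cong_add_power_prime assms(1)) (use insert in auto)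
  also have "alg_cong p \<dots> (f a ^ p + (\<Sum>i\<in>A. f i ^ p))"
    by (intro alg_cong_add insert.IH) (use insert in auto)
  finally show ?case using insert by simp
qed (use prime_gt_0_nat[OF assms(1)] in \<open>auto simp: power_0_left\<close>)

lemma alg_cong_diff_power_prime:
  assumes "prime p" "odd p" "algebraic_int x" "algebraic_int y"
  shows "alg_cong p ((x - y) ^ p) (x ^ p - y ^ p)"
  using alg_cong_add_power_prime[of p x "-y"] assms by simp

section \<open>Divergence of the sum of prime reciprocals\<close>

lemma sum_inverse_squares_le: 
  assumes "w \<ge> 1" shows "(\<Sum>r\<in>{w<..R}. 1 / real r ^ 2) \<le> 1 / real w"
proof (cases "R \<ge> w")
  case True
  \<comment> \<open>The term \<open>1 / real R\<close> makes the bound telescope, which the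
    induction needs.\<close>
  have "(\<Sum>r\<in>{w<..R}. 1 / real r ^ 2) \<le> 1 / real w - 1 / real R"
    using True
  proof (induction R rule: dec_induct)
    case (step n)
    have "{w<..Suc n} = insert (Suc n) {w<..n}" using step by auto
    hence "(\<Sum>r\<in>{w<..Suc n}. 1 / real r ^ 2) = 1 / real (Suc n) ^ 2 + (\<Sum>r\<in>{w<..n}. 1 / real r ^ 2)"
      by simp
    also have "\<dots> \<le> 1 / real (Suc n) ^ 2 + (1 / real w - 1 / real n)"
      using step.IH by simp
    also have "1 / real (Suc n) ^ 2 \<le> 1 / real n - 1 / real (Suc n)"
    proof -
      have n: "real n > 0" using step assms by simp
      have "1 / real n - 1 / real (Suc n) = 1 / (real n * real (Suc n))"
        using n by (simp add: field_simps)
      moreover have "1 / (real (Suc n))\<^sup>2 \<le> 1 / (real n * real (Suc n))"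
        using n by (intro divide_left_mono) (auto simp: power2_eq_square)
      ultimately show ?thesis by simp
    qed
    finally show ?case by simp
  qed simp
  also have "\<dots> \<le> 1 / real w" by simp
  finally show ?thesis .
qed simp

lemma squarefree_eq_prod_prime_factors:
  assumes "squarefree (n::nat)" shows "n = \<Prod>(prime_factors n)"
proof -
  have n: "n \<noteq> 0" using assms by (auto intro!: Nat.gr0I)
  have "n = (\<Prod>p\<in>prime_factors n. p ^ multiplicity p n)"
    using prod_prime_factors[OF n] by simp
  also have "\<dots> = \<Prod>(prime_factors n)"
    using assms squarefree_factorial_semiring'[OF n] by (intro prod.cong) auto
  finally show ?thesis .
qed

lemma ln_le_harmonic_sum: "ln (real N + 1) \<le> (\<Sum>n=1..N. 1 / real n)"
proof (induction N)
  case (Suc N)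
  have "real (Suc N) + 1 = (real N + 1) * (1 + 1 / real (Suc N))" by (simp add: field_simps)
  hence "ln (real (Suc N) + 1) = ln (real N + 1) + ln (1 + 1 / real (Suc N))"
    by (simp only:) (rule ln_mult_pos, auto simp: add_pos_pos)
  also have "\<dots> \<le> (\<Sum>n=1..N. 1 / real n) + 1 / real (Suc N)"
    by (intro add_mono Suc.IH ln_add_one_self_le_self) simp
  finally show ?case by simp
qed simp

text \<open>Each \<open>n\<close> is determined by its squarefree part and its square part, so the
  harmonic sum is at most the product of \<open>1 + 1 / p\<close> over the primes up to
  \<open>N\<close> times the sum of the \<open>1 / b ^ 2\<close>. The first factor is bounded by
  \<open>1 + x \<le> exp x\<close>, the second by 2.\<close>

lemma harmonic_sum_le_exp_prime_sum:
  "(\<Sum>n=1..N. 1 / real n) \<le> 2 * exp (\<Sum>p | prime p \<and> p \<le> N. 1 / real p)"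
proof -
  define P where "P = {p. prime p \<and> p \<le> N}"
  define i where "i = (\<lambda>n::nat. (prime_factors (squarefree_part n), square_part n))"
  define g where "g = (\<lambda>(X::nat set, b::nat). (\<Prod>p\<in>X. 1 / real p) * (1 / real b ^ 2))"
  have fin: "finite P" unfolding P_def by simp
  have dec: "n = \<Prod>(prime_factors (squarefree_part n)) * square_part n ^ 2" for n :: nat
    using squarefree_decompose[of n] squarefree_eq_prod_prime_factors[of "squarefree_part n"] by simp
  have inj: "inj_on i {1..N}"
    by (rule inj_onI) (metis (no_types, lifting) dec i_def prod.inject)
  have sub: "i ` {1..N} \<subseteq> Pow P \<times> {1..N}"
  proof (rule image_subsetI)
    fix n assume n: "n \<in> {1..N}"
    have dvd: "squarefree_part n dvd n" "square_part n ^ 2 dvd n"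
      using squarefree_decompose[of n] by (metis dvd_triv_left) auto
    have "p \<in> P" if "p \<in> prime_factors (squarefree_part n)" for p
    proof -
      have "prime p" "p dvd squarefree_part n" using that by auto
      hence "p dvd n" using dvd(1) dvd_trans by blast
      thus ?thesis using \<open>prime p\<close> n by (auto simp: P_def dest: dvd_imp_le)
    qed
    moreover have "square_part n dvd n" using dvd(2) by (metis dvd_mult_left power2_eq_square)
    hence "square_part n \<in> {1..N}" using n by (auto dest: dvd_imp_le intro!: Suc_leI Nat.gr0I)
    ultimately show "i n \<in> Pow P \<times> {1..N}" unfolding i_def by auto
  qed
  have "(\<Sum>n=1..N. 1 / real n) = (\<Sum>n\<in>{1..N}. g (i n))"
  proof (intro sum.cong refl)
    fix n :: nat
    have "real n = (\<Prod>p\<in>prime_factors (squarefree_part n). real p) * real (square_part n) ^ 2"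
      by (subst dec) simp
    thus "1 / real n = g (i n)"
      by (simp add: g_def i_def prod_dividef)
  qed
  also have "\<dots> = (\<Sum>x\<in>i ` {1..N}. g x)" using inj by (simp add: sum.reindex)
  also have "\<dots> \<le> (\<Sum>x\<in>Pow P \<times> {1..N}. g x)"
    using sub fin by (intro sum_mono2) (auto simp: g_def intro!: divide_nonneg_nonneg prod_nonneg)
  also have "\<dots> = (\<Sum>X\<in>Pow P. \<Prod>p\<in>X. 1 / real p) * (\<Sum>b\<in>{1..N}. 1 / real b ^ 2)"
    unfolding g_def by (simp add: sum.cartesian_product sum_product)
  \<comment> \<open>Squarefree parts correspond to sets of primes; summing over all subsets of
    \<open>P\<close> is multiplying out an Euler product.\<close>
  also have "(\<Sum>X\<in>Pow P. \<Prod>p\<in>X. 1 / real p) = (\<Prod>p\<in>P. 1 / real p + 1)"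
    using prod_add[OF fin, of "\<lambda>p. 1 / real p" "\<lambda>_. 1"] by simp
  also have "(\<Prod>p\<in>P. 1 / real p + 1) * (\<Sum>b\<in>{1..N}. 1 / real b ^ 2) \<le> exp (\<Sum>p\<in>P. 1 / real p) * 2"
  proof (rule mult_mono)
    show "(\<Prod>p\<in>P. 1 / real p + 1) \<le> exp (\<Sum>p\<in>P. 1 / real p)"
      unfolding exp_sum[OF fin] by (intro prod_mono) (auto simp: add.commute intro: exp_ge_add_one_self)
    have "(\<Sum>b\<in>{1..N}. 1 / real b ^ 2) \<le> (\<Sum>b\<in>insert 1 {1<..N}. 1 / real b ^ 2)"
      by (intro sum_mono2) auto
    also have "\<dots> \<le> 2" using sum_inverse_squares_le[of 1 N] by simp
    finally show "(\<Sum>b\<in>{1..N}. 1 / real b ^ 2) \<le> 2" .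
  qed (auto intro!: sum_nonneg)
  finally show ?thesis by (simp add: P_def mult.commute)
qed

lemma prime_reciprocal_sums_unbounded:
  obtains P where "finite P" "\<And>p. p \<in> P \<Longrightarrow> prime p \<and> p > (w::nat)" "(\<Sum>p\<in>P. 1 / real p) > K"
proof -
  define S where "S = (\<Sum>p | prime p \<and> p \<le> w. 1 / real p)"
  \<comment> \<open>With this \<open>N\<close> the harmonic sum exceeds
    \<open>2 * exp (K + S)\<close>, so the prime sum up to \<open>N\<close> exceeds
    \<open>K + S\<close>; dropping the primes up to \<open>w\<close> costs \<open>S\<close>.\<close>
  define N where "N = nat \<lceil>exp (2 * exp (K + S))\<rceil>"
  have "exp (2 * exp (K + S)) < real N + 1" unfolding N_def by linarith
  hence N: "2 * exp (K + S) < ln (real N + 1)" by (subst exp_less_cancel_iff[symmetric]) simp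
  define P where "P = {p. prime p \<and> p > w \<and> p \<le> N}"
  have "2 * exp (K + S) < 2 * exp (\<Sum>p | prime p \<and> p \<le> N. 1 / real p)"
    using N ln_le_harmonic_sum[of N] harmonic_sum_le_exp_prime_sum[of N] by linarith
  hence "K + S < (\<Sum>p | prime p \<and> p \<le> N. 1 / real p)" by simp
  also have "\<dots> \<le> (\<Sum>p\<in>P \<union> {p. prime p \<and> p \<le> w}. 1 / real p)"
    by (intro sum_mono2) (auto simp: P_def)
  also have "\<dots> = (\<Sum>p\<in>P. 1 / real p) + S"
    unfolding S_def by (intro sum.union_disjoint) (auto simp: P_def)
  finally show ?thesis by (intro that[of P]) (auto simp: P_def)
qed

section \<open>Squarefree numbers in arithmetic progressions\<close>

text \<open>As \<open>W\<close> is invertible modulo \<open>D\<close>, all such \<open>j\<close> lie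
  in one residue class modulo \<open>D\<close>, and on a class \<open>j div D\<close> is
  injective.\<close>

lemma card_progression_dvd_le:
  assumes "coprime D W" "D > 0"
  shows "card {j::nat. j < J \<and> D dvd s + W * j} \<le> J div D + 1"
proof -
  let ?S = "{j. j < J \<and> D dvd s + W * j}"
  have "inj_on (\<lambda>j. j div D) ?S"
  proof (rule inj_onI)
    fix j j' assume "j \<in> ?S" "j' \<in> ?S" and eq: "j div D = j' div D"
    hence "[s + W * j = s + W * j'] (mod D)" by (simp add: cong_def)
    hence "[W * j = W * j'] (mod D)" by (simp add: cong_add_lcancel_nat)
    hence "[j = j'] (mod D)" using assms(1) by (simp add: cong_mult_lcancel_nat coprime_commute)
    thus "j = j'" using eq by (metis cong_def div_mult_mod_eq)
  qed
  moreover have "(\<lambda>j. j div D) ` ?S \<subseteq> {..J div D}" by (auto intro: div_le_mono)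
  ultimately have "card ?S \<le> card {..J div D}" by (intro card_inj_on_le) auto
  thus ?thesis by simp
qed

text \<open>A sieve: terms divisible by some \<open>r ^ 2\<close> or by \<open>q\<close> are thrown
  out. The terms are coprime to \<open>W\<close>, hence to all primes up to \<open>w\<close>, so
  only \<open>r > w\<close> occur, and each loses at most \<open>J / r ^ 2 + 1\<close>
  terms.\<close>

lemma card_progression_squarefree_ge:
  assumes W: "\<And>p. prime p \<Longrightarrow> p \<le> w \<Longrightarrow> p dvd W" and w: "w \<ge> 1" and s: "0 < s" "s \<le> W" "coprime s W"
    and q: "prime q" "q > w" "coprime q W"
  shows "real (card {j. j < J \<and> squarefree (s + W * j) \<and> \<not> q dvd s + W * j})
           \<ge> real J - (real J / w + sqrt (W * J)) - (real J / w + 1)"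
proof -
  define R where "R = nat \<lfloor>sqrt (W * J)\<rfloor>"
  define G where "G = {j. j < J \<and> squarefree (s + W * j) \<and> \<not> q dvd s + W * j}"
  define B where "B = (\<lambda>D. {j. j < J \<and> D dvd s + W * j})"
  define Q where "Q = {r \<in> {w<..R}. coprime r W}"
  have cW: "coprime (s + W * j) W" for j
    using s(3) by (metis gcd_add_mult coprime_iff_gcd_eq_1 gcd.commute add.commute mult.commute)
  have "{..<J} \<subseteq> G \<union> (\<Union>r\<in>Q. B (r ^ 2)) \<union> B q"
  proof
    fix j assume j: "j \<in> {..<J}"
    show "j \<in> G \<union> (\<Union>r\<in>Q. B (r ^ 2)) \<union> B q"
    proof (cases "squarefree (s + W * j)")
      case True thus ?thesis using j by (auto simp: G_def B_def)
    next
      case False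
      then obtain r where r: "prime r" "r ^ 2 dvd s + W * j"
        using squarefree_factorial_semiring[of "s + W * j"] s by auto
      have "coprime (r ^ 2) W" using cW r(2) by (meson coprime_divisors dvd_refl)
      hence cr: "coprime r W" by simp
      hence "r > w" using W[OF r(1)] r(1) by (metis coprime_absorb_left not_le not_prime_unit)
      \<comment> \<open>As \<open>s \<le> W\<close> and \<open>j < J\<close>, every term is at most
        \<open>W * J\<close>, which limits \<open>r\<close> to \<open>R\<close>.\<close>
      have "r ^ 2 \<le> s + W * j" using r s by (intro dvd_imp_le) auto
      also have "\<dots> \<le> W + W * j" using s by simp
      also have "\<dots> = W * Suc j" by simp
      also have "\<dots> \<le> W * J" using j by (intro mult_le_mono) auto
      finally have "real r ^ 2 \<le> real (W * J)" by (metis of_nat_le_iff of_nat_power)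
      hence "real r \<le> sqrt (W * J)" by (intro real_le_rsqrt) simp
      hence "r \<le> R" unfolding R_def by (simp add: le_nat_floor)
      hence "r \<in> Q" using cr \<open>r > w\<close> by (auto simp: Q_def)
      thus ?thesis using j r by (auto simp: B_def)
    qed
  qed
  moreover have fins: "finite G" "finite Q" "finite (B D)" for D by (auto simp: G_def B_def Q_def)
  ultimately have "card {..<J} \<le> card (G \<union> (\<Union>r\<in>Q. B (r ^ 2)) \<union> B q)"
    by (intro card_mono) auto
  also have "\<dots> \<le> card (G \<union> (\<Union>r\<in>Q. B (r ^ 2))) + card (B q)" by (rule card_Un_le)
  also have "\<dots> \<le> card G + card (\<Union>r\<in>Q. B (r ^ 2)) + card (B q)" using card_Un_le by (intro add_mono) auto
  also have "\<dots> \<le> card G + (\<Sum>r\<in>Q. card (B (r ^ 2))) + card (B q)"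
    using fins by (intro add_mono card_UN_le) auto
  finally have "real J \<le> real (card G) + (\<Sum>r\<in>Q. real (card (B (r ^ 2)))) + real (card (B q))"
    by (simp flip: of_nat_sum of_nat_add)
  moreover have "real (card (B D)) \<le> J / D + 1" if "coprime D W" "D > 0" for D
  proof -
    have "real (card (B D)) \<le> real (J div D + 1)"
      using card_progression_dvd_le[OF that, of J s] unfolding B_def by linarith
    thus ?thesis using of_nat_div_le_of_nat[of J D, where 'a = real] by simp
  qed
  note BD = this
  have "real (card (B q)) \<le> J / w + 1"
  proof -
    have "real (card (B q)) \<le> J / q + 1" using q by (intro BD) (auto simp: prime_gt_0_nat)
    also have "J / q \<le> J / w" using q w by (intro divide_left_mono) auto
    finally show ?thesis by simp
  qed
  moreover have "(\<Sum>r\<in>Q. real (card (B (r ^ 2)))) \<le> J / w + sqrt (W * J)"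
  proof -
    have "(\<Sum>r\<in>Q. real (card (B (r ^ 2)))) \<le> (\<Sum>r\<in>Q. J * (1 / real r ^ 2) + 1)"
      by (intro sum_mono) (use BD[of "_ ^ 2"] in \<open>auto simp: Q_def\<close>)
    also have "\<dots> \<le> (\<Sum>r\<in>{w<..R}. J * (1 / real r ^ 2) + 1)"
      by (intro sum_mono2) (auto simp: Q_def)
    also have "\<dots> = J * (\<Sum>r\<in>{w<..R}. 1 / real r ^ 2) + real (R - w)"
      by (simp add: sum.distrib sum_distrib_left)
    also have "\<dots> \<le> J * (1 / w) + sqrt (W * J)"
    proof (intro add_mono mult_left_mono sum_inverse_squares_le w)
      have "real (R - w) \<le> real R" by simp
      also have "\<dots> \<le> sqrt (W * J)" unfolding R_def by (simp add: of_nat_nat)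
      finally show "real (R - w) \<le> sqrt (W * J)" .
    qed auto
    finally show ?thesis by simp
  qed
  ultimately show ?thesis unfolding G_def by linarith
qed

section \<open>A norm form\<close>

lemma prod_dvd_det:
  fixes A :: "int mat"
  assumes A: "A \<in> carrier_mat n n" and D: "\<And>i j. i < n \<Longrightarrow> j < n \<Longrightarrow> D i dvd A $$ (i, j)"
  shows "(\<Prod>i = 0..<n. D i) dvd det A"
  unfolding det_def'[OF A]
proof (intro dvd_sum dvd_mult prod_dvd_prod D)
  fix \<sigma> i assume "\<sigma> \<in> {p. p permutes {0..<n}}" "i \<in> {0..<n}"
  thus "\<sigma> i < n" using permutes_in_image[of \<sigma> "{0..<n}" i] by auto
qed auto

text \<open>Multiplying by the unitriangular matrix \<open>V\<close> from the left keeps the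
  determinant, and afterwards row \<open>i\<close> is divisible by \<open>D i\<close>.\<close>

lemma prod_dvd_det_unitriangular:
  fixes A :: "int mat"
  assumes A: "A \<in> carrier_mat n n"
    and V: "\<And>i. i < n \<Longrightarrow> V i i = 1" "\<And>i j. i < n \<Longrightarrow> j < i \<Longrightarrow> V i j = 0"
    and D: "\<And>i j. i < n \<Longrightarrow> j < n \<Longrightarrow> D i dvd (\<Sum>l<n. V i l * A $$ (l, j))"
  shows "(\<Prod>i = 0..<n. D i) dvd det A"
proof -
  define E where "E = mat n n (\<lambda>(i, j). V i j)"
  have E: "E \<in> carrier_mat n n" by (simp add: E_def)
  have "det E = prod_list (diag_mat E)"
    by (rule det_upper_triangular[OF _ E]) (use V in \<open>auto simp: E_def\<close>)
  also have "\<dots> = 1"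
    using V by (simp add: prod_list_diag_prod E_def)
  finally have "det E = 1" .
  hence "det (E * A) = det A" using det_mult[OF E A] by simp
  moreover have "(\<Prod>i = 0..<n. D i) dvd det (E * A)"
    by (rule prod_dvd_det) (use A D in \<open>auto simp: E_def scalar_prod_def lessThan_atLeast0\<close>)
  ultimately show ?thesis by simp
qed

lemma abs_det_le:
  fixes A :: "int mat"
  assumes A: "A \<in> carrier_mat n n" and B: "\<And>i j. i < n \<Longrightarrow> j < n \<Longrightarrow> \<bar>A $$ (i, j)\<bar> \<le> B"
  shows "\<bar>det A\<bar> \<le> fact n * B ^ n"
proof -
  have "\<bar>det A\<bar> \<le> (\<Sum>\<sigma> | \<sigma> permutes {0..<n}. \<bar>signof \<sigma> * (\<Prod>i = 0..<n. A $$ (i, \<sigma> i))\<bar>)"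
    unfolding det_def'[OF A] by (rule sum_abs)
  also have "\<dots> \<le> (\<Sum>\<sigma> | \<sigma> permutes {0..<n}. B ^ n)"
  proof (rule sum_mono)
    fix \<sigma> assume \<sigma>: "\<sigma> \<in> {\<sigma>. \<sigma> permutes {0..<n}}"
    have "\<bar>signof \<sigma> * (\<Prod>i = 0..<n. A $$ (i, \<sigma> i))\<bar> = (\<Prod>i = 0..<n. \<bar>A $$ (i, \<sigma> i)\<bar>)"
      by (simp add: abs_mult abs_prod sign_def)
    also have "\<dots> \<le> (\<Prod>i = 0..<n. B)"
      by (intro prod_mono) (use \<sigma> B permutes_in_image[of \<sigma> "{0..<n}"] in auto)
    finally show "\<bar>signof \<sigma> * (\<Prod>i = 0..<n. A $$ (i, \<sigma> i))\<bar> \<le> B ^ n" by simp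
  qed
  also have "\<dots> = fact n * B ^ n"
    by (simp add: card_permutations[of _ n])
  finally show ?thesis .
qed

lemma poly_eq_sum_lessThan:
  fixes q :: "int poly"
  assumes "degree q < k" shows "poly q x = (\<Sum>i<k. coeff q i * x ^ i)"
proof -
  have "poly q x = (\<Sum>i\<le>degree q. coeff q i * x ^ i)" by (rule poly_altdef)
  also have "\<dots> = (\<Sum>i<k. coeff q i * x ^ i)"
    by (rule sum.mono_neutral_left) (use assms in \<open>auto simp: coeff_eq_0\<close>)
  finally show ?thesis .
qed

lemma cpoly_eq_sum_lessThan:
  assumes "degree q < k" shows "cpoly q x = (\<Sum>i<k. of_int (coeff q i) * x ^ i)"
proof -
  have "cpoly q x = (\<Sum>i\<le>degree q. of_int (coeff q i) * x ^ i)" by (rule cpoly_altdef)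
  also have "\<dots> = (\<Sum>i<k. of_int (coeff q i) * x ^ i)"
    by (rule sum.mono_neutral_left) (use assms in \<open>auto simp: coeff_eq_0\<close>)
  finally show ?thesis .
qed

text \<open>Pseudo-division scales the dividend by a power of the leading coefficient of
  \<open>f\<close>, which is 1 here.\<close>

lemma monic_division:
  fixes f g :: "int poly"
  assumes "lead_coeff f = 1"
  obtains q r where "g = f * q + r" "r = 0 \<or> degree r < degree f"
proof -
  have "f \<noteq> 0" using assms by auto
  obtain q r where qr: "pseudo_divmod g f = (q, r)" by (cases "pseudo_divmod g f")
  show ?thesis
    using pseudo_divmod[OF \<open>f \<noteq> 0\<close> qr] assms by (intro that[of q r]) auto
qed

text \<open>The form is the determinant of multiplication by \<open>\<Sum>s<k. c s * \<beta> ^ s\<close> on the lattice spanned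
  by \<open>1, \<beta>, \<dots>, \<beta> ^ (k - 1)\<close>. If \<open>f t \<equiv> 0\<close> modulo \<open>n\<close>, then \<open>(1, t, t\<^sup>2, \<dots>)\<close> is a left eigenvector
  modulo \<open>n\<close> with eigenvalue \<open>\<Sum>s<k. c s * t ^ s\<close>.\<close>

lemma norm_form_exists:
  fixes f :: "int poly" and \<beta> :: complex
  assumes monic: "lead_coeff f = 1" and k: "degree f = k" "k \<ge> 2" and root: "cpoly f \<beta> = 0"
    and min: "\<And>g. g \<noteq> 0 \<Longrightarrow> degree g < k \<Longrightarrow> cpoly g \<beta> \<noteq> 0"
  obtains N :: "(nat \<Rightarrow> int) \<Rightarrow> int" and C :: nat where
    "\<And>c Y. (\<And>s. s < k \<Longrightarrow> \<bar>c s\<bar> \<le> int Y) \<Longrightarrow> \<bar>N c\<bar> \<le> int (C * Y ^ k)"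
    "\<And>c s. s < k \<Longrightarrow> c s \<noteq> 0 \<Longrightarrow> N c \<noteq> 0"
    "\<And>c n t. int n dvd poly f t \<Longrightarrow> int n dvd (\<Sum>s<k. c s * t ^ s) \<Longrightarrow> int n dvd N c"
    "\<And>c p a b. prime p \<Longrightarrow> int p dvd poly f a \<Longrightarrow> int p dvd poly f b \<Longrightarrow> \<not> int p dvd a - b \<Longrightarrow>
       int p dvd (\<Sum>s<k. c s * a ^ s) \<Longrightarrow> int p dvd (\<Sum>s<k. c s * b ^ s) \<Longrightarrow> int p ^ 2 dvd N c"
proof -
  have "\<forall>m. \<exists>r q. monom 1 m = f * q + r \<and> degree r < k"
  proof
    fix m
    obtain q r where "monom 1 m = f * q + r" "r = 0 \<or> degree r < degree f"
      using monic_division[OF monic] by blast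
    thus "\<exists>r q. monom 1 m = f * q + r \<and> degree r < k" using k by auto
  qed
  then obtain R Q where R: "\<And>m. monom 1 m = f * Q m + R m" "\<And>m. degree (R m) < k" by metis
  \<comment> \<open>\<open>R m\<close> is the remainder of \<open>x ^ m\<close> modulo
    \<open>f\<close>, so column \<open>j\<close> holds the coordinates of
    \<open>\<beta> ^ j * (\<Sum>s<k. c s * \<beta> ^ s)\<close>. Only \<open>R m\<close> with
    \<open>m < 2 * k\<close> enter.\<close>
  define A where "A = (\<lambda>c. mat k k (\<lambda>(i, j). \<Sum>s<k. c s * coeff (R (s + j)) i))"
  define N where "N = (\<lambda>c. det (A c))"
  have A: "A c \<in> carrier_mat k k" for c by (simp add: A_def)

  define B where "B = (\<Sum>m<2*k. \<Sum>i<k. \<bar>coeff (R m) i\<bar>)"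
  have B: "\<bar>coeff (R m) i\<bar> \<le> B" if "m < 2 * k" "i < k" for m i
  proof -
    have "\<bar>coeff (R m) i\<bar> \<le> (\<Sum>i<k. \<bar>coeff (R m) i\<bar>)" using that by (intro member_le_sum) auto
    also have "\<dots> \<le> B" unfolding B_def using that
      by (intro member_le_sum[of m _ "\<lambda>m. \<Sum>i<k. \<bar>coeff (R m) i\<bar>"]) (auto intro: sum_nonneg)
    finally show ?thesis .
  qed
  have B0: "B \<ge> 0" unfolding B_def by (intro sum_nonneg) auto

  have bound: "\<bar>N c\<bar> \<le> int (fact k * (k * nat B) ^ k * Y ^ k)" if c: "\<And>s. s < k \<Longrightarrow> \<bar>c s\<bar> \<le> int Y" for c Y
  proof -
    have "\<bar>N c\<bar> \<le> fact k * (int k * (int Y * B)) ^ k"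
      unfolding N_def
    proof (rule abs_det_le[OF A])
      fix i j assume ij: "i < k" "j < k"
      have "\<bar>A c $$ (i, j)\<bar> \<le> (\<Sum>s<k. \<bar>c s * coeff (R (s + j)) i\<bar>)"
        using ij by (simp add: A_def sum_abs)
      also have "\<dots> \<le> (\<Sum>s<k. int Y * B)"
        unfolding abs_mult using ij by (intro sum_mono mult_mono c B) auto
      finally show "\<bar>A c $$ (i, j)\<bar> \<le> int k * (int Y * B)" by simp
    qed
    also have "\<dots> = int (fact k * (k * nat B) ^ k * Y ^ k)"
      using B0 by (simp add: power_mult_distrib mult_ac)
    finally show ?thesis .
  qed

  \<comment> \<open>A kernel vector \<open>v\<close> would make the product of
    \<open>\<Sum>s<k. c s * \<beta> ^ s\<close> and \<open>\<Sum>j<k. v $ j * \<beta> ^ j\<close>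
    vanish, although by minimality neither factor does.\<close>
  have nonzero: "N c \<noteq> 0" if c: "s < k" "c s \<noteq> 0" for c s
  proof
    assume "N c = 0"
    then obtain v where v: "v \<in> carrier_vec k" "v \<noteq> 0\<^sub>v k" "A c *\<^sub>v v = 0\<^sub>v k"
      using det_0_iff_vec_prod_zero[OF A] unfolding N_def by blast
    then obtain j0 where j0: "j0 < k" "v $ j0 \<noteq> 0"
      by (metis carrier_vecD eq_vecI index_zero_vec)
    have row: "(\<Sum>j<k. \<Sum>s<k. c s * v $ j * coeff (R (s + j)) i) = 0" if "i < k" for i
    proof -
      have "0 = (A c *\<^sub>v v) $ i" using v(3) that by simp
      also have "\<dots> = (\<Sum>j<k. (\<Sum>s<k. c s * coeff (R (s + j)) i) * v $ j)"
        using that v(1) by (simp add: A_def scalar_prod_def lessThan_atLeast0)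
      also have "\<dots> = (\<Sum>j<k. \<Sum>s<k. c s * v $ j * coeff (R (s + j)) i)"
        by (simp add: sum_distrib_left mult_ac)
      finally show ?thesis by simp
    qed
    have pow: "\<beta> ^ m = (\<Sum>i<k. of_int (coeff (R m) i) * \<beta> ^ i)" for m
    proof -
      have "\<beta> ^ m = cpoly (monom 1 m) \<beta>" by (simp add: poly_monom)
      also have "\<dots> = cpoly (R m) \<beta>" by (subst R(1)) (simp add: cpoly_add cpoly_mult root)
      finally show ?thesis using cpoly_eq_sum_lessThan[OF R(2)] by simp
    qed
    define g where "g = (\<lambda>u :: nat \<Rightarrow> int. \<Sum>s<k. monom (u s) s)"
    have g: "cpoly (g u) \<beta> \<noteq> 0" if "s < k" "u s \<noteq> 0" for u s
    proof (rule min)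
      have "coeff (g u) s = u s" using that by (simp add: g_def coeff_sum)
      thus "g u \<noteq> 0" using that by auto
      have "degree (g u) \<le> k - 1" unfolding g_def
        by (rule degree_sum_le) (auto intro!: order.trans[OF degree_monom_le])
      thus "degree (g u) < k" using k by simp
    qed
    have "cpoly (g c) \<beta> * cpoly (g (\<lambda>j. v $ j)) \<beta> = (\<Sum>s<k. \<Sum>j<k. of_int (c s * v $ j) * \<beta> ^ (s + j))"
      by (simp add: g_def cpoly_sum poly_monom sum_product power_add mult_ac)
    also have "\<dots> = (\<Sum>j<k. \<Sum>s<k. of_int (c s * v $ j) * \<beta> ^ (s + j))" by (rule sum.swap)
    also have "\<dots> = (\<Sum>j<k. \<Sum>s<k. \<Sum>i<k. of_int (c s * v $ j * coeff (R (s + j)) i) * \<beta> ^ i)"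
      by (subst pow) (simp add: sum_distrib_left mult_ac)
    also have "\<dots> = (\<Sum>j<k. \<Sum>i<k. \<Sum>s<k. of_int (c s * v $ j * coeff (R (s + j)) i) * \<beta> ^ i)"
      by (intro sum.cong sum.swap refl)
    also have "\<dots> = (\<Sum>i<k. \<Sum>j<k. \<Sum>s<k. of_int (c s * v $ j * coeff (R (s + j)) i) * \<beta> ^ i)"
      by (rule sum.swap)
    also have "\<dots> = (\<Sum>i<k. of_int (\<Sum>j<k. \<Sum>s<k. c s * v $ j * coeff (R (s + j)) i) * \<beta> ^ i)"
      by (simp add: sum_distrib_right)
    also have "\<dots> = 0" using row by simp
    finally show False using g[of s c, OF c] g[of j0 "\<lambda>j. v $ j", OF j0] by simp
  qed

  have eigen: "n dvd (\<Sum>l<k. t ^ l * A c $$ (l, j))"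
    if t: "n dvd poly f t" "n dvd (\<Sum>s<k. c s * t ^ s)" and j: "j < k" for n c t j
  proof -
    have R': "poly (R m) t = t ^ m - poly f t * poly (Q m) t" for m
      using arg_cong[OF R(1)[of m], of "\<lambda>q. poly q t"] by (simp add: poly_monom)
    have "(\<Sum>l<k. t ^ l * A c $$ (l, j)) = (\<Sum>l<k. \<Sum>s<k. c s * (coeff (R (s + j)) l * t ^ l))"
      using j by (simp add: A_def sum_distrib_left mult_ac)
    also have "\<dots> = (\<Sum>s<k. c s * poly (R (s + j)) t)"
      by (subst sum.swap) (simp add: poly_eq_sum_lessThan[OF R(2)] sum_distrib_left)
    also have "\<dots> = t ^ j * (\<Sum>s<k. c s * t ^ s) - poly f t * (\<Sum>s<k. c s * poly (Q (s + j)) t)"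
      by (simp add: R' sum_distrib_left sum_subtractf power_add algebra_simps)
    finally show ?thesis using t by simp
  qed

  have dvd1: "int n dvd N c" if t: "int n dvd poly f t" "int n dvd (\<Sum>s<k. c s * t ^ s)" for c n t
  proof -
    \<comment> \<open>The identity matrix with its first row replaced by the left eigenvector;
      \<open>t ^ 0 = 1\<close> keeps it unitriangular.\<close>
    define V where "V = (\<lambda>i j. if i = 0 then t ^ j else if i = j then 1 else 0 :: int)"
    define D where "D = (\<lambda>i. if i = (0::nat) then int n else 1)"
    have "(\<Prod>i = 0..<k. D i) dvd N c"
      unfolding N_def
      by (rule prod_dvd_det_unitriangular[OF A, of V])
         (use eigen[OF t] in \<open>auto simp: V_def D_def\<close>)
    moreover have "{0..<k} = insert 0 {1..<k}" using k by auto
    hence "(\<Prod>i = 0..<k. D i) = int n" by (simp add: D_def)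
    ultimately show ?thesis by simp
  qed

  have dvd2: "int p ^ 2 dvd N c"
    if p: "prime p" "int p dvd poly f a" "int p dvd poly f b" "\<not> int p dvd a - b"
      "int p dvd (\<Sum>s<k. c s * a ^ s)" "int p dvd (\<Sum>s<k. c s * b ^ s)" for c p a b
  proof -
    \<comment> \<open>Divided differences of the two eigenvectors for \<open>a\<close> and
      \<open>b\<close>. As \<open>w 0 = 0\<close> and \<open>w 1 = 1\<close>, they can serve as
      second row of a unitriangular matrix, and they inherit divisibility by \<open>p\<close>
      because \<open>p\<close> does not divide \<open>b - a\<close>.\<close>
    define w where "w = (\<lambda>j. \<Sum>s<j. b ^ s * a ^ (j - 1 - s))"
    have w: "(b - a) * w j = b ^ j - a ^ j" for j
    proof (cases j)
      case (Suc i)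
      thus ?thesis using diff_power_eq_sum[of b i a]
        by (simp add: w_def mult.commute del: sum.lessThan_Suc power_Suc)
    qed (simp add: w_def)
    have w_dvd: "int p dvd (\<Sum>l<k. w l * A c $$ (l, j))" if "j < k" for j
    proof -
      have "(b - a) * (\<Sum>l<k. w l * A c $$ (l, j)) = (\<Sum>l<k. (b - a) * w l * A c $$ (l, j))"
        by (simp add: sum_distrib_left mult_ac)
      also have "\<dots> = (\<Sum>l<k. b ^ l * A c $$ (l, j)) - (\<Sum>l<k. a ^ l * A c $$ (l, j))"
        unfolding w by (simp add: sum_subtractf left_diff_distrib)
      also have "int p dvd \<dots>"
        using eigen[OF p(3,6) that] eigen[OF p(2,5) that] by (rule dvd_diff)
      finally show ?thesis
        using p(1,4) by (auto simp: prime_dvd_mult_iff dvd_diff_commute)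
    qed
    define V where "V = (\<lambda>i j. if i = 0 then a ^ j else if i = 1 then w j else if i = j then 1 else 0 :: int)"
    define D where "D = (\<lambda>i. if i < (2::nat) then int p else 1)"
    have "(\<Prod>i = 0..<k. D i) dvd N c"
      unfolding N_def
    proof (rule prod_dvd_det_unitriangular[OF A, of V])
      fix i j assume "i < k" "j < k"
      thus "D i dvd (\<Sum>l<k. V i l * A c $$ (l, j))"
        using eigen[OF p(2,5)] w_dvd by (cases "i = 0"; cases "i = 1") (simp_all add: V_def D_def)
    qed (auto simp: V_def w_def)
    moreover have "{0..<k} = insert 0 (insert 1 {2..<k})" using k by auto
    hence "(\<Prod>i = 0..<k. D i) = int p ^ 2" by (simp add: D_def power2_eq_square)
    ultimately show ?thesis by simp
  qed
  show ?thesis by (rule that[OF bound nonzero dvd1 dvd2])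
qed

section \<open>No irreducible polynomial has two roots modulo almost every prime\<close>

lemma squarefree_dvd_if_prime_factors_dvd:
  assumes "squarefree (n::nat)" "\<And>p. prime p \<Longrightarrow> p dvd n \<Longrightarrow> int p dvd x"
  shows "int n dvd x"
proof -
  have "int (\<Prod>A) dvd x" if "finite A" "\<And>p. p \<in> A \<Longrightarrow> prime p \<and> int p dvd x" for A
    using that
  proof (induction A rule: finite_induct)
    case (insert p A)
    have "coprime p (\<Prod>A)"
      by (rule prod_coprime_right) (use insert in \<open>auto intro!: primes_coprime\<close>)
    hence "coprime (int p) (int (\<Prod>A))" by (simp only: coprime_int_iff)
    hence "int p * int (\<Prod>A) dvd x" using insert by (intro divides_mult) auto
    thus ?case using insert by simp
  qed simp
  from this[of "prime_factors n"] show ?thesis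
    using assms squarefree_eq_prod_prime_factors[OF assms(1)] by auto
qed

lemma int_chinese_remainder_primes:
  fixes u :: "nat \<Rightarrow> int"
  assumes "finite A" "\<And>p. p \<in> A \<Longrightarrow> prime p"
  obtains t :: int where "\<And>p. p \<in> A \<Longrightarrow> int p dvd t - u p"
proof -
  have "\<forall>p\<in>A. \<forall>q\<in>A. p \<noteq> q \<longrightarrow> coprime p q" using assms(2) by (auto intro: primes_coprime)
  then obtain x where x: "\<forall>p\<in>A. [x = nat (u p mod int p)] (mod p)"
    using chinese_remainder_nat[OF assms(1), of "\<lambda>p. p" "\<lambda>p. nat (u p mod int p)"]
    by blast
  show ?thesis
  proof (rule that[of "int x"])
    fix p assume p: "p \<in> A"
    hence "p > 0" using assms(2) prime_gt_0_nat by blast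
    have "[int x = int (nat (u p mod int p))] (mod int p)" using x p by (simp only: cong_int_iff)
    hence "[int x = u p] (mod int p)" using \<open>p > 0\<close> by (simp add: cong_def)
    thus "int p dvd int x - u p" by (simp add: cong_iff_dvd_diff)
  qed
qed

text \<open>Pigeonhole: the box \<open>{0..Y} ^ k\<close> has more than \<open>n\<close> points, so
  two of them agree modulo \<open>n\<close> after evaluation at \<open>t\<close>; their difference
  is the required vector.\<close>

lemma small_vector_mod:
  fixes n k :: nat and t :: int
  assumes "n \<ge> 1" "k \<ge> 1"
  obtains c :: "nat \<Rightarrow> int" and Y s where "Y ^ k \<le> n" "c \<in> {..<k} \<rightarrow>\<^sub>E {- int Y..int Y}" "s < k" "c s \<noteq> 0"
    "int n dvd (\<Sum>s<k. c s * t ^ s)"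
proof -
  \<comment> \<open>\<open>Y = m - 1\<close> is the integer part of the \<open>k\<close>-th root of
    \<open>n\<close>.\<close>
  define m where "m = (LEAST m. n < m ^ k)"
  have "n < (Suc n) ^ k" using self_le_power[of "Suc n" k] assms(2) by simp
  hence m: "n < m ^ k" unfolding m_def by (rule LeastI)
  have "m > 0" using m assms by (intro Nat.gr0I) (auto simp: power_0_left)
  then obtain Y where Y: "m = Suc Y" by (cases m) auto
  have "\<not> n < Y ^ k" using not_less_Least[of Y "\<lambda>m. n < m ^ k"] Y unfolding m_def by simp
  hence Yk: "Y ^ k \<le> n" by simp
  define V where "V = {..<k} \<rightarrow>\<^sub>E {0..int Y}"
  define ev where "ev = (\<lambda>c::nat \<Rightarrow> int. (\<Sum>s<k. c s * t ^ s) mod int n)"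
  have "card {0..<int n} < card V" using m Y by (simp add: V_def card_PiE nat_add_distrib)
  moreover have "ev ` V \<subseteq> {0..<int n}" using assms by (auto simp: ev_def)
  ultimately have "\<not> inj_on ev V" by (meson card_inj_on_le finite_atLeastLessThan_int not_le)
  then obtain c c' where c: "c \<in> V" "c' \<in> V" "c \<noteq> c'" "ev c = ev c'" by (auto simp: inj_on_def)
  obtain s where s: "s < k" "c s \<noteq> c' s"
    using c(1-3) unfolding V_def by (metis PiE_ext lessThan_iff)
  define e where "e = (\<lambda>s\<in>{..<k}. c s - c' s)"
  show ?thesis
  proof (rule that[OF Yk, of e s])
    show "e \<in> {..<k} \<rightarrow>\<^sub>E {- int Y..int Y}"
    proof (rule PiE_I)
      fix i assume i: "i \<in> {..<k}"
      have "c i \<in> {0..int Y}" "c' i \<in> {0..int Y}" 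
        using PiE_mem[OF _ i] c(1,2) unfolding V_def by blast+
      thus "e i \<in> {- int Y..int Y}" using i by (auto simp: e_def)
    qed (auto simp: e_def)
    show "s < k" "e s \<noteq> 0" using s by (auto simp: e_def)
    have "(\<Sum>s<k. e s * t ^ s) = (\<Sum>s<k. c s * t ^ s) - (\<Sum>s<k. c' s * t ^ s)"
      by (simp add: e_def left_diff_distrib sum_subtractf)
    thus "int n dvd (\<Sum>s<k. e s * t ^ s)"
      using c(4) by (simp add: ev_def mod_eq_dvd_iff)
  qed
qed

lemma cong_poly_dvd:
  fixes f :: "int poly"
  assumes "m dvd x - y" shows "m dvd poly f x - poly f y"
proof -
  have "poly f x = (x - y) * poly (synthetic_div f y) x + poly f y"
    by (subst synthetic_div_correct'[of y f, symmetric]) (simp add: algebra_simps)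
  hence "x - y dvd poly f x - poly f y" by simp
  thus ?thesis using assms dvd_trans by blast
qed

lemma cong_sum_dvd:
  fixes c :: "nat \<Rightarrow> int"
  assumes "m dvd x - y" "m dvd (\<Sum>s<k. c s * x ^ s)" shows "m dvd (\<Sum>s<k. c s * y ^ s)"
proof -
  define f where "f = (\<Sum>s<k. monom (c s) s)"
  have "poly f z = (\<Sum>s<k. c s * z ^ s)" for z by (simp add: f_def poly_sum poly_monom)
  hence "m dvd (\<Sum>s<k. c s * x ^ s) - (\<Sum>s<k. c s * y ^ s)" using cong_poly_dvd[OF assms(1), of f] by simp
  from dvd_diff[OF assms(2) this] show ?thesis by simp
qed

text \<open>Pairs \<open>(q, n)\<close> with \<open>q \<in> P\<close> and \<open>n \<in> S q\<close>
  are counted in two ways. Each pair is encoded by a small vector and a small cofactor, which gives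
  \<open>O(X ^ k)\<close> pairs; the squarefree multiples of each \<open>q\<close> give at least a
  constant times \<open>X ^ k / q\<close> pairs, and these add up to too many.\<close>

lemma not_two_roots_mod_almost_all_primes:
  fixes f :: "int poly" and \<beta> :: complex
  assumes monic: "lead_coeff f = 1" and k: "degree f = k" "k \<ge> 2" and root: "cpoly f \<beta> = 0"
    and min: "\<And>g. g \<noteq> 0 \<Longrightarrow> degree g < k \<Longrightarrow> cpoly g \<beta> \<noteq> 0"
    and two: "\<And>p. prime p \<Longrightarrow> p > w\<^sub>0 \<Longrightarrow>
      \<exists>a b. int p dvd poly f a \<and> int p dvd poly f b \<and> \<not> int p dvd a - b"
  shows False
proof -
  obtain N C where N: "\<And>c Y. (\<And>s. s < k \<Longrightarrow> \<bar>c s\<bar> \<le> int Y) \<Longrightarrow> \<bar>N c\<bar> \<le> int (C * Y ^ k)"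
    "\<And>c s. s < k \<Longrightarrow> c s \<noteq> 0 \<Longrightarrow> N c \<noteq> 0"
    "\<And>c n t. int n dvd poly f t \<Longrightarrow> int n dvd (\<Sum>s<k. c s * t ^ s) \<Longrightarrow> int n dvd N c"
    "\<And>c p a b. prime p \<Longrightarrow> int p dvd poly f a \<Longrightarrow> int p dvd poly f b \<Longrightarrow> \<not> int p dvd a - b \<Longrightarrow>
       int p dvd (\<Sum>s<k. c s * a ^ s) \<Longrightarrow> int p dvd (\<Sum>s<k. c s * b ^ s) \<Longrightarrow> int p ^ 2 dvd N c"
    using norm_form_exists[OF monic k root min] by blast
  obtain a b where ab: "\<And>p. prime p \<Longrightarrow> p > w\<^sub>0 \<Longrightarrow>
      int p dvd poly f (a p) \<and> int p dvd poly f (b p) \<and> \<not> int p dvd a p - b p"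
    using two by metis
  \<comment> \<open>Primes above \<open>w\<close> exceed every cofactor \<open>e\<close> and have
    two roots; the 8 keeps each loss \<open>J / w\<close> of the sieve below
    \<open>J / 8\<close>.\<close>
  define w where "w = C + w\<^sub>0 + 8"
  define W :: nat where "W = fact w"
  have W: "W \<ge> 1" by (simp add: W_def Suc_leI)
  have W_dvd: "p dvd W" if "prime p" "p \<le> w" for p
    unfolding W_def using that by (intro dvd_fact) (auto simp: prime_gt_0_nat Suc_le_eq)
  \<comment> \<open>The condition \<open>n \<equiv> 1\<close> modulo \<open>W\<close> forces all
    prime factors of \<open>n\<close> above \<open>w\<close>.\<close>
  have big: "p > w" if "prime p" "p dvd n" "[n = 1] (mod W)" for p n
  proof (rule ccontr)
    assume "\<not> p > w"
    hence "p dvd W" using that W_dvd by simp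
    hence "[n = 1] (mod p)" using that(3) cong_dvd_modulus_nat by blast
    hence "p dvd 1" using that(2) cong_dvd_iff by blast
    thus False using that(1) by simp
  qed
  \<comment> \<open>The upper bound \<open>X ^ k * 3 ^ k * (2 * C + 1)\<close> divided by the factor
    \<open>X ^ k / (4 * W)\<close> of the lower bound.\<close>
  define K where "K = 4 * real W * 3 ^ k * (2 * real C + 1)"
  obtain P where P: "finite P" "\<And>p. p \<in> P \<Longrightarrow> prime p \<and> p > w" "(\<Sum>p\<in>P. 1 / real p) > K"
    using prime_reciprocal_sums_unbounded by blast
  have P0: "p > 0" if "p \<in> P" for p using P(2)[OF that] by simp
  \<comment> \<open>This makes \<open>X ^ k\<close> a multiple of \<open>q * W\<close> for every
    \<open>q \<in> P\<close>, with a quotient \<open>J\<close> of at least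
    \<open>16 * W\<close>.\<close>
  define X where "X = 16 * W * W * \<Prod>P"
  have X: "X \<ge> 1" using W P(1) P0 unfolding X_def by (simp add: Suc_leI prod_pos)
  define S where "S = (\<lambda>q. {n. n \<le> X ^ k \<and> [n = 1] (mod W) \<and> squarefree n \<and> q dvd n})"
  define T where "T = ({..<k} \<rightarrow>\<^sub>E {- int X..int X}) \<times> {- int C..int C}"
  have finS: "finite (S q)" for q by (rule finite_subset[of _ "{..X ^ k}"]) (auto simp: S_def)
  have finT: "finite T" by (auto simp: T_def intro: finite_PiE)

  \<comment> \<open>The residue \<open>t\<close> is the root \<open>b\<close> modulo the marked
    prime \<open>q\<close> and the root \<open>a\<close> modulo all other prime factors of
    \<open>n\<close>; this is what lets \<open>q\<close> be recovered.\<close>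
  define H where "H = (\<lambda>q n c e t. (c, e) \<in> T \<and> e \<noteq> 0 \<and> N c = int n * e \<and> int n dvd (\<Sum>s<k. c s * t ^ s) \<and>
          (\<forall>p. prime p \<longrightarrow> p dvd n \<longrightarrow> int p dvd t - (if p = q then b p else a p)))"
  have "\<exists>c e t. H q n c e t" if q: "q \<in> P" and n: "n \<in> S q" for q n
  proof -
    have n': "n > 0" "n \<le> X ^ k" "[n = 1] (mod W)" "squarefree n" "q dvd n"
      using n by (auto simp: S_def intro!: Nat.gr0I)
    obtain t where t: "\<And>p. p \<in> prime_factors n \<Longrightarrow> int p dvd t - (if p = q then b p else a p)"
      using int_chinese_remainder_primes[of "prime_factors n" "\<lambda>p. if p = q then b p else a p"] by auto
    have t': "int p dvd t - (if p = q then b p else a p)" if "prime p" "p dvd n" for p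
      using t[of p] that n' by (auto simp: prime_factors_dvd)
    have "int n dvd poly f t"
    proof (rule squarefree_dvd_if_prime_factors_dvd[OF n'(4)])
      fix p assume p: "prime p" "p dvd n"
      define u where "u = (if p = q then b p else a p)"
      have "p > w\<^sub>0" using big[OF p n'(3)] by (simp add: w_def)
      hence "int p dvd poly f u" using ab[OF p(1)] unfolding u_def by auto
      moreover have "int p dvd poly f t - poly f u" using t'[OF p] unfolding u_def by (rule cong_poly_dvd)
      ultimately show "int p dvd poly f t" by (metis dvd_add diff_add_cancel)
    qed
    have n1: "n \<ge> 1" and k1: "k \<ge> 1" using n' k by auto
    obtain c Y s where c: "Y ^ k \<le> n" "c \<in> {..<k} \<rightarrow>\<^sub>E {- int Y..int Y}" "s < k" "c s \<noteq> 0"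
        "int n dvd (\<Sum>s<k. c s * t ^ s)"
      by (rule small_vector_mod[OF n1 k1, of t]) (rule that)
    have "int n dvd N c" using N(3)[OF \<open>int n dvd poly f t\<close> c(5)] .
    then obtain e where e: "N c = int n * e" by blast
    have "N c \<noteq> 0" using N(2) c by blast
    hence "e \<noteq> 0" using e by auto
    have "\<bar>c s\<bar> \<le> int Y" if "s < k" for s
    proof -
      have "c s \<in> {- int Y..int Y}" by (rule PiE_mem[OF c(2)]) (use that in simp)
      thus ?thesis by auto
    qed
    \<comment> \<open>Since \<open>Y ^ k \<le> n\<close>, the norm is at most \<open>C * n\<close>,
      so its cofactor \<open>e\<close> is at most \<open>C\<close> in absolute value.\<close>
    hence "\<bar>N c\<bar> \<le> int (C * Y ^ k)" by (rule N(1))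
    also have "\<dots> \<le> int (C * n)" using c(1) by (simp add: mult_left_mono)
    finally have "int n * \<bar>e\<bar> \<le> int n * int C" unfolding e abs_mult by (simp add: mult.commute)
    hence "\<bar>e\<bar> \<le> int C" using n' by simp
    have "Y ^ k \<le> X ^ k" using c(1) n' by simp
    hence "Y \<le> X" using k by (subst (asm) power_mono_iff) auto
    hence "{..<k} \<rightarrow>\<^sub>E {- int Y..int Y} \<subseteq> {..<k} \<rightarrow>\<^sub>E {- int X..int X}" by (intro PiE_mono) auto
    hence "(c, e) \<in> T" using c(2) \<open>\<bar>e\<bar> \<le> int C\<close> unfolding T_def mem_Sigma_iff by (simp add: subset_iff abs_le_iff)
    hence "H q n c e t" using \<open>e \<noteq> 0\<close> e c(5) t' unfolding H_def by blast
    thus ?thesis by blast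
  qed
  then obtain c e t where "\<And>q n. q \<in> P \<Longrightarrow> n \<in> S q \<Longrightarrow> H q n (c q n) (e q n) (t q n)"
    by metis
  hence cet: "q \<in> P \<Longrightarrow> n \<in> S q \<Longrightarrow> (c q n, e q n) \<in> T"
      "q \<in> P \<Longrightarrow> n \<in> S q \<Longrightarrow> e q n \<noteq> 0"
      "q \<in> P \<Longrightarrow> n \<in> S q \<Longrightarrow> N (c q n) = int n * e q n"
      "q \<in> P \<Longrightarrow> n \<in> S q \<Longrightarrow> int n dvd (\<Sum>s<k. c q n s * t q n ^ s)"
      "q \<in> P \<Longrightarrow> n \<in> S q \<Longrightarrow> prime p \<Longrightarrow> p dvd n \<Longrightarrow> int p dvd t q n - (if p = q then b p else a p)"
    for q n p
    unfolding H_def by blast+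

  have card_symm: "card {- int x..int x} = 2 * x + 1" for x by simp
  \<comment> \<open>\<open>n\<close> is recovered from \<open>N c = int n * e\<close>. If
    \<open>q\<close> and another prime \<open>q'\<close> shared \<open>n\<close>, \<open>c\<close>
    and \<open>e\<close>, then \<open>c\<close> would vanish modulo \<open>q\<close> at both
    \<open>a q\<close> and \<open>b q\<close>, so \<open>q ^ 2\<close> would divide
    \<open>int n * e\<close>; but \<open>n\<close> is squarefree and \<open>e\<close> is nonzero of
    absolute value at most \<open>C < q\<close>.\<close>
  have "inj_on (\<lambda>(q, n). (c q n, e q n)) (Sigma P S)"
  proof (rule inj_onI, clarify)
    fix q n q' n' assume q: "q \<in> P" "n \<in> S q" and q': "q' \<in> P" "n' \<in> S q'"
      and eqc: "c q n = c q' n'" and eqe: "e q n = e q' n'"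
    have "int n * e q n = int n' * e q n" 
      by (rule trans[OF cet(3)[OF q, symmetric] cet(3)[OF q', folded eqc eqe]])
    hence [simp]: "n' = n" using cet(2)[OF q] by simp
    have n: "[n = 1] (mod W)" "squarefree n" "q dvd n" using q by (auto simp: S_def)
    have "q = q'"
    proof (rule ccontr)
      assume neq: "q \<noteq> q'"
      have pq: "prime q" "q > w" using P(2) q by auto
      hence "q > w\<^sub>0" "q > C" by (auto simp: w_def)
      let ?c = "c q n"
      have "int q dvd int n" using n(3) by simp
      have 1: "int q dvd (\<Sum>s<k. ?c s * t q n ^ s)" "int q dvd (\<Sum>s<k. ?c s * t q' n ^ s)"
        using dvd_trans[OF \<open>int q dvd int n\<close>] cet(4)[OF q] cet(4)[OF q'] eqc by auto
      have 2: "int q dvd t q n - b q" "int q dvd t q' n - a q"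
        using cet(5)[OF q, of q] cet(5)[OF q', of q] pq n(3) neq by auto
      have "int q dvd (\<Sum>s<k. ?c s * a q ^ s)" "int q dvd (\<Sum>s<k. ?c s * b q ^ s)"
        using cong_sum_dvd[OF 2(2) 1(2)] cong_sum_dvd[OF 2(1) 1(1)] .
      hence "int q ^ 2 dvd N ?c" using ab[OF pq(1) \<open>q > w\<^sub>0\<close>] pq(1) by (intro N(4)[of q "a q" "b q"]) auto
      also obtain m where m: "n = q * m" using n(3) by blast
      hence "N ?c = int q * (int m * e q n)" using cet(3)[OF q] by simp
      finally have "int q dvd int m * e q n" using pq by (simp add: power2_eq_square)
      moreover have "\<not> q dvd m"
      proof
        assume "q dvd m"
        hence "q ^ 2 dvd n" using m by (simp add: power2_eq_square)
        hence "q dvd 1" using n(2) squarefreeD by blast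
        thus False using pq(1) by simp
      qed
      ultimately have "int q dvd e q n" using pq(1) by (simp add: prime_dvd_mult_iff)
      hence "int q \<le> \<bar>e q n\<bar>" using dvd_imp_le_int[OF cet(2)[OF q], of "int q"] by simp
      also have "\<dots> \<le> int C" using cet(1)[OF q] unfolding T_def mem_Sigma_iff by (simp add: abs_le_iff)
      finally show False using \<open>q > C\<close> by simp
    qed
    thus "q = q' \<and> n = n'" by simp
  qed
  moreover have "(\<lambda>(q, n). (c q n, e q n)) ` Sigma P S \<subseteq> T" by (auto intro: cet(1))
  ultimately have "card (Sigma P S) \<le> card T" using finT by (rule card_inj_on_le)
  also have "card T = (2 * X + 1) ^ k * (2 * C + 1)"
    by (simp add: T_def card_cartesian_product card_PiE card_symm del: card_atLeastAtMost_int)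
  also have "\<dots> \<le> (3 * X) ^ k * (2 * C + 1)" using X by (intro mult_le_mono power_mono) auto
  finally have "(\<Sum>q\<in>P. card (S q)) \<le> (3 * X) ^ k * (2 * C + 1)"
    using P(1) finS by (simp add: card_SigmaI)
  hence "real (\<Sum>q\<in>P. card (S q)) \<le> real ((3 * X) ^ k * (2 * C + 1))" by (simp only: of_nat_le_iff)
  hence upper: "(\<Sum>q\<in>P. real (card (S q))) \<le> real X ^ k * (3 ^ k * (2 * real C + 1))"
    by (simp add: power_mult_distrib algebra_simps)

  \<comment> \<open>The numbers \<open>q * (s + W * j)\<close> are counted, where \<open>s\<close>
    is an inverse of \<open>q\<close> modulo \<open>W\<close> and \<open>s + W * j\<close> is
    squarefree and prime to \<open>q\<close>.\<close>
  have lower: "real (card (S q)) \<ge> real X ^ k / (4 * W) * (1 / q)" if q: "q \<in> P" for q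
  proof -
    have pq: "prime q" "q > w" using P(2) q by auto
    have "coprime q W"
    proof (rule ccontr)
      assume "\<not> coprime q W"
      hence "q dvd W" using prime_imp_coprime[OF pq(1)] by blast
      hence "q \<le> w" using pq(1) unfolding W_def by (simp add: prime_dvd_fact_iff)
      thus False using pq by simp
    qed
    from cong_solve_coprime_nat[OF this] obtain s0 where s0: "[q * s0 = 1] (mod W)" by auto
    \<comment> \<open>The representative is taken in \<open>{1..W}\<close> because the sieve
      requires \<open>0 < s\<close>.\<close>
    define s where "s = (if s0 mod W = 0 then W else s0 mod W)"
    have s: "0 < s" "s \<le> W" using W by (auto simp: s_def less_imp_le)
    have "[s = s0] (mod W)" by (auto simp: s_def cong_def)
    from cong_trans[OF cong_scalar_left[OF this] s0] have qs: "[q * s = 1] (mod W)" .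
    from cong_imp_coprime[OF cong_sym[OF qs]] have "coprime (q * s) W" by simp
    hence sW: "coprime s W" by simp
    define J where "J = X ^ k div (q * W)"
    have "q dvd \<Prod>P" using P(1) q by (rule dvd_prodI)
    then obtain z where z: "\<Prod>P = q * z" by blast
    have Xq: "X = q * W * (16 * W * z)" by (simp add: X_def z)
    hence "q * W dvd X" by simp
    have "X dvd X ^ k" using k by (intro dvd_power) auto
    hence "q * W dvd X ^ k" using \<open>q * W dvd X\<close> by (rule dvd_trans[rotated])
    hence J: "X ^ k = q * W * J" by (simp add: J_def)
    have "X \<le> X ^ k" using X k by (intro self_le_power) auto
    hence "q * W * (16 * W * z) \<le> q * W * J" unfolding J[symmetric] Xq[symmetric] .
    hence "16 * W * z \<le> J" using W P0[OF q] by simp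
    moreover have "z \<ge> 1" using z X by (auto simp: X_def intro!: Suc_leI Nat.gr0I)
    hence "16 * W * 1 \<le> 16 * W * z" by (intro mult_le_mono) auto
    ultimately have JW: "16 * W \<le> J" by (metis mult_1_right order.trans)
    define G where "G = {j. j < J \<and> squarefree (s + W * j) \<and> \<not> q dvd s + W * j}"
    \<comment> \<open>The losses are at most \<open>J / 8\<close>, \<open>J / 4\<close>,
      \<open>J / 8\<close> and \<open>J / 4\<close>, which leaves \<open>J / 4\<close>
      terms.\<close>
    have "real J - (real J / w + sqrt (W * J)) - (real J / w + 1) \<le> card G"
      unfolding G_def
      by (rule card_progression_squarefree_ge)
         (use s sW pq \<open>coprime q W\<close> W_dvd in \<open>auto simp: w_def\<close>)
    moreover have "real J / w \<le> real J / 8" by (intro divide_left_mono) (auto simp: w_def)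
    moreover have "sqrt (W * J) \<le> J / 4"
    proof (rule real_le_lsqrt)
      have "real W * real J \<le> real J / 16 * real J" using JW by (intro mult_right_mono) (auto simp flip: of_nat_mult)
      thus "real (W * J) \<le> (real J / 4)\<^sup>2" by (simp add: power2_eq_square)
    qed auto
    moreover have "J \<ge> 16" using JW W by linarith
    hence "1 \<le> real J / 4" by simp
    ultimately have G: "real J / 4 \<le> card G" by linarith
    have "card G \<le> card (S q)"
    proof (rule card_inj_on_le[OF _ _ finS])
      show "inj_on (\<lambda>j. q * (s + W * j)) G" using P0[OF q] W by (auto simp: inj_on_def)
      show "(\<lambda>j. q * (s + W * j)) ` G \<subseteq> S q"
      proof (rule image_subsetI)
        fix j assume j: "j \<in> G"
        have "s + W * j \<le> W + W * j" using s by simp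
        also have "\<dots> = W * Suc j" by simp
        also have "\<dots> \<le> W * J" using j by (intro mult_le_mono) (auto simp: G_def)
        finally have "q * (s + W * j) \<le> X ^ k" unfolding J by (simp add: mult.assoc)
        moreover have "[q * (s + W * j) = 1] (mod W)"
          using qs by (simp add: cong_def distrib_left mult.left_commute[of q W])
        moreover have "squarefree (q * (s + W * j))"
          using j pq by (intro squarefree_mult_coprime) (auto simp: G_def squarefree_prime intro: prime_imp_coprime)
        ultimately show "q * (s + W * j) \<in> S q" by (auto simp: S_def)
      qed
    qed
    hence "real J / 4 \<le> card (S q)" using G by simp
    moreover have "real X ^ k = real q * real W * real J" using J by (metis of_nat_mult of_nat_power)
    hence "real X ^ k / (4 * W) * (1 / q) = real J / 4" using W P0[OF q] by (simp add: field_simps)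
    ultimately show ?thesis by simp
  qed
  have "real X ^ k / (4 * W) * K < real X ^ k / (4 * W) * (\<Sum>q\<in>P. 1 / real q)"
    using P(3) X W by (intro mult_strict_left_mono) auto
  also have "\<dots> \<le> (\<Sum>q\<in>P. real (card (S q)))"
    unfolding sum_distrib_left using lower by (intro sum_mono)
  also note upper
  also have "real X ^ k * (3 ^ k * (2 * real C + 1)) = real X ^ k / (4 * W) * K"
    using W by (simp add: K_def field_simps)
  finally show False by simp
qed

section \<open>Moebius inversion and the Dold condition\<close>

lemma moebius_mu_mult_prime:
  assumes "prime p" "\<not> p dvd d" shows "moebius_mu (p * d) = - moebius_mu d"
proof -
  have "d \<noteq> 0" using assms(2) by (metis dvd_0_right)
  have "coprime p d" using assms prime_imp_coprime by blast
  hence "squarefree (p * d) \<longleftrightarrow> squarefree d"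
    using assms(1) by (meson squarefree_mult_coprime squarefree_prime squarefree_mono dvd_triv_right)
  moreover have "prime_factors (p * d) = insert p (prime_factors d)"
    using \<open>d \<noteq> 0\<close> assms by (auto simp: prime_factors_product prime_prime_factors)
  moreover have "p \<notin> prime_factors d" using assms by auto
  ultimately show ?thesis by (simp add: moebius_mu_def)
qed

text \<open>For a prime \<open>p\<close> dividing \<open>n\<close>, the squarefree divisors
  \<open>d\<close> prime to \<open>p\<close> cancel against the \<open>p * d\<close>.\<close>

lemma sum_moebius_mu_divisors:
  assumes "n > 0" shows "(\<Sum>d | d dvd n. moebius_mu d) = (if n = 1 then 1 else 0)"
proof (cases "n = 1")
  case True
  thus ?thesis by (simp add: moebius_mu_def)
next
  case False
  then obtain p where p: "prime p" "p dvd n" using prime_factor_nat by blast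
  define D where "D = {d. d dvd n \<and> squarefree d \<and> \<not> p dvd d}"
  have fin: "finite {d. d dvd n}" using assms by (rule finite_divisors_nat)
  have finD: "finite D" by (rule finite_subset[OF _ fin]) (auto simp: D_def)
  have split: "{d. d dvd n \<and> squarefree d} = D \<union> (*) p ` D"
  proof (intro equalityI subsetI)
    fix d assume d: "d \<in> {d. d dvd n \<and> squarefree d}"
    show "d \<in> D \<union> (*) p ` D"
    proof (cases "p dvd d")
      case True
      then obtain m where m: "d = p * m" by blast
      have "\<not> p dvd m"
      proof
        assume "p dvd m"
        hence "p ^ 2 dvd d" using m by (simp add: power2_eq_square)
        hence "p dvd 1" using d squarefreeD by blast
        thus False using p(1) by simp
      qed
      moreover have "m dvd n" "squarefree m"
        using d m by (auto intro: squarefree_mono[of m d] dvd_trans[of m "p * m"])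
      ultimately show ?thesis using m by (auto simp: D_def)
    qed (use d in \<open>auto simp: D_def\<close>)
  next
    fix d assume "d \<in> D \<union> (*) p ` D"
    thus "d \<in> {d. d dvd n \<and> squarefree d}"
    proof
      assume "d \<in> (*) p ` D"
      then obtain m where m: "m dvd n" "squarefree m" "\<not> p dvd m" "d = p * m" by (auto simp: D_def)
      have cop: "coprime p m" using p m prime_imp_coprime by blast
      have "squarefree (p * m)" using cop squarefree_prime[OF p(1)] m(2) by (rule squarefree_mult_coprime)
      moreover have "p * m dvd n" using p(2) m(1) cop by (rule divides_mult)
      ultimately show ?thesis using m(4) by simp
    qed (auto simp: D_def)
  qed
  have "(\<Sum>d | d dvd n. moebius_mu d) = (\<Sum>d | d dvd n \<and> squarefree d. moebius_mu d)"
    by (rule sum.mono_neutral_right) (use fin in \<open>auto simp: moebius_mu_def\<close>)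
  also have "\<dots> = (\<Sum>d\<in>D. moebius_mu d) + (\<Sum>d\<in>(*) p ` D. moebius_mu d)"
    unfolding split by (rule sum.union_disjoint) (use finD in \<open>auto simp: D_def\<close>)
  also have "(\<Sum>d\<in>(*) p ` D. moebius_mu d) = (\<Sum>d\<in>D. moebius_mu (p * d))"
    using p(1) by (subst sum.reindex) (auto simp: inj_on_def)
  also have "\<dots> = (\<Sum>d\<in>D. - moebius_mu d)"
    by (intro sum.cong refl moebius_mu_mult_prime p(1)) (auto simp: D_def)
  finally show ?thesis using False by (simp add: sum_negf)
qed

text \<open>Moebius inversion turns the sum into \<open>int n * b n\<close>. The formula for
  \<open>A\<close> is required at the divisors of \<open>n\<close> only, so \<open>b\<close> may
  depend on \<open>n\<close>.\<close>

lemma dvd_moebius_sum_if_divisor_sum: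
  fixes A b :: "nat \<Rightarrow> int"
  assumes "n > 0" and A: "\<And>m. m dvd n \<Longrightarrow> A m = (\<Sum>k | k dvd m. int k * b k)"
  shows "int n dvd (\<Sum>d | d dvd n. moebius_mu d * A (n div d))"
proof -
  define D where "D = {d. d dvd n}"
  have fin: "finite D" unfolding D_def using assms(1) by (rule finite_divisors_nat)
  have *: "{k. k dvd n div d} = {k \<in> D. d * k dvd n}" if "d \<in> D" for d
    using that assms(1) by (auto simp: D_def dvd_div_iff_mult mult.commute intro: dvd_trans dvd_mult_right)
  have "(\<Sum>d\<in>D. moebius_mu d * A (n div d)) = (\<Sum>d\<in>D. \<Sum>k | k \<in> D \<and> d * k dvd n. moebius_mu d * (int k * b k))"
  proof (intro sum.cong refl)
    fix d assume d: "d \<in> D"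
    hence "n div d dvd n" by (auto simp: D_def div_dvd_iff_mult)
    thus "moebius_mu d * A (n div d) = (\<Sum>k | k \<in> D \<and> d * k dvd n. moebius_mu d * (int k * b k))"
      using A *[OF d] by (simp add: sum_distrib_left)
  qed
  also have "\<dots> = (\<Sum>k\<in>D. \<Sum>d | d \<in> D \<and> d * k dvd n. moebius_mu d * (int k * b k))"
    by (rule sum.swap_restrict[OF fin fin])
  also have "\<dots> = (\<Sum>k\<in>D. if k = n then int n * b n else 0)"
  proof (intro sum.cong refl)
    fix k assume k: "k \<in> D"
    have "(\<Sum>d | d \<in> D \<and> d * k dvd n. moebius_mu d * (int k * b k)) = (\<Sum>d | d dvd n div k. moebius_mu d) * (int k * b k)"
      unfolding *[OF k] sum_distrib_right by (intro sum.cong) (auto simp: mult.commute)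
    moreover have "n div k > 0" using k assms(1) by (auto simp: D_def dvd_div_eq_0_iff intro!: Nat.gr0I)
    moreover have "n div k = 1 \<longleftrightarrow> k = n" using k assms(1) by (auto simp: D_def)
    ultimately show "(\<Sum>d | d \<in> D \<and> d * k dvd n. moebius_mu d * (int k * b k)) = (if k = n then int n * b n else 0)"
      using sum_moebius_mu_divisors[of "n div k"] by auto
  qed
  also have "\<dots> = int n * b n" using fin by (simp add: D_def)
  finally show ?thesis by (simp add: D_def)
qed

text \<open>The divisors of \<open>p * m\<close> are the \<open>d\<close> and the
  \<open>p * d\<close> with \<open>d dvd m\<close>, of opposite Moebius values. So the Dold sum at
  \<open>p * m\<close> combines the differences \<open>A (p * e) - A e\<close> for
  \<open>e dvd m\<close>, and induction removes all but \<open>e = m\<close>.\<close>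

lemma dold_condition_prime_cong:
  assumes A: "dold_condition A" and p: "prime p"
  shows "m > 0 \<Longrightarrow> \<not> p dvd m \<Longrightarrow> int p dvd A (p * m) - A m"
proof (induction m rule: less_induct)
  case (less m)
  define D where "D = {d. d dvd m}"
  have fin: "finite D" unfolding D_def using less.prems(1) by (rule finite_divisors_nat)
  have p0: "p > 0" using p prime_gt_0_nat by blast
  have nD: "\<not> p dvd d" if "d \<in> D" for d using that less.prems(2) by (auto simp: D_def intro: dvd_trans)
  have divs: "{d. d dvd p * m} = D \<union> (*) p ` D"
  proof (intro equalityI subsetI)
    fix d assume d: "d \<in> {d. d dvd p * m}"
    show "d \<in> D \<union> (*) p ` D"
    proof (cases "p dvd d")
      case True
      then obtain e where "d = p * e" by blast
      thus ?thesis using d p0 by (auto simp: D_def)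
    next
      case False
      hence "coprime d p" using p prime_imp_coprime coprime_commute by blast
      thus ?thesis using d by (auto simp: D_def coprime_dvd_mult_right_iff)
    qed
  qed (auto simp: D_def)
  have "int (p * m) dvd (\<Sum>d | d dvd p * m. moebius_mu d * A (p * m div d))"
    using A p0 less.prems(1) unfolding dold_condition_def by (metis nat_0_less_mult_iff)
  hence "int p dvd (\<Sum>d | d dvd p * m. moebius_mu d * A (p * m div d))"
    by (metis dvd_mult_left of_nat_mult)
  also have "(\<Sum>d | d dvd p * m. moebius_mu d * A (p * m div d)) =
      (\<Sum>d\<in>D. moebius_mu d * A (p * m div d)) + (\<Sum>d\<in>(*) p ` D. moebius_mu d * A (p * m div d))"
    unfolding divs by (rule sum.union_disjoint) (use fin in \<open>auto dest: nD\<close>)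
  also have "(\<Sum>d\<in>(*) p ` D. moebius_mu d * A (p * m div d)) = (\<Sum>d\<in>D. moebius_mu (p * d) * A (p * m div (p * d)))"
    using p0 by (subst sum.reindex) (auto simp: inj_on_def)
  also have "\<dots> = (\<Sum>d\<in>D. - moebius_mu d * A (m div d))"
    using p0 by (intro sum.cong refl) (simp add: moebius_mu_mult_prime[OF p nD])
  also have "(\<Sum>d\<in>D. moebius_mu d * A (p * m div d)) + \<dots> =
      (\<Sum>d\<in>D. moebius_mu d * (A (p * (m div d)) - A (m div d)))"
    unfolding sum.distrib[symmetric]
    by (intro sum.cong refl) (auto simp: D_def div_mult_swap algebra_simps)
  also have "D = insert 1 (D - {1})" by (auto simp: D_def)
  also have "(\<Sum>d\<in>\<dots>. moebius_mu d * (A (p * (m div d)) - A (m div d))) =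
      (A (p * m) - A m) + (\<Sum>d\<in>D - {1}. moebius_mu d * (A (p * (m div d)) - A (m div d)))"
    using fin by (subst sum.insert) (auto simp: moebius_mu_def)
  finally have 1: "int p dvd (A (p * m) - A m) + (\<Sum>d\<in>D - {1}. moebius_mu d * (A (p * (m div d)) - A (m div d)))" .
  have 2: "int p dvd (\<Sum>d\<in>D - {1}. moebius_mu d * (A (p * (m div d)) - A (m div d)))"
  proof (intro dvd_sum dvd_mult)
    fix d assume d: "d \<in> D - {1}"
    hence d': "d dvd m" "d > 1" using less.prems(1) by (auto simp: D_def intro!: Nat.gr0I simp: nat_neq_iff)
    have "m div d dvd m" using dvd_div_mult_self[OF d'(1)] by (metis dvd_triv_left)
    moreover have "m div d > 0" using d' less.prems(1) by (auto simp: dvd_div_eq_0_iff intro!: Nat.gr0I)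
    moreover have "m div d < m" using d'(2) less.prems(1) by simp
    ultimately show "int p dvd A (p * (m div d)) - A (m div d)"
      using less.prems(2) by (intro less.IH) (auto dest: dvd_trans)
  qed
  from dvd_diff[OF 1 2] show ?case by simp
qed

section \<open>Logarithmic derivatives of power series\<close>

text \<open>\<open>T\<close> is \<open>- X * G' / G\<close>, written without division.\<close>

definition neg_logderiv :: "complex fps \<Rightarrow> complex fps \<Rightarrow> bool" where
  "neg_logderiv G T \<longleftrightarrow> - (fps_X * fps_deriv G) = T * G"

lemma fps_nth_X_deriv: "fps_nth (fps_X * fps_deriv (G :: complex fps)) m = of_nat m * fps_nth G m"
  by (cases m) auto

lemma neg_logderiv_mult:
  "neg_logderiv G T \<Longrightarrow> neg_logderiv H S \<Longrightarrow> neg_logderiv (G * H) (T + S)"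
proof -
  assume G: "neg_logderiv G T" and H: "neg_logderiv H S"
  have "- (fps_X * fps_deriv (G * H)) = - (fps_X * fps_deriv G) * H + G * - (fps_X * fps_deriv H)"
    by (simp add: algebra_simps)
  also have "\<dots> = (T + S) * (G * H)"
    using G H unfolding neg_logderiv_def by (simp add: algebra_simps)
  finally show ?thesis unfolding neg_logderiv_def .
qed

lemma neg_logderiv_prod:
  "(\<And>i. i \<in> A \<Longrightarrow> neg_logderiv (G i) (T i)) \<Longrightarrow> neg_logderiv (prod G A) (sum T A)"
  by (induction A rule: infinite_finite_induct)
     (auto intro: neg_logderiv_mult, auto simp: neg_logderiv_def)

lemma neg_logderiv_cancel:
  assumes "neg_logderiv (G * H) (T + S)" "neg_logderiv H S" "H \<noteq> 0"
  shows "neg_logderiv G T"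
proof -
  have "- (fps_X * fps_deriv (G * H)) = - (fps_X * fps_deriv G) * H + G * - (fps_X * fps_deriv H)"
    by (simp add: algebra_simps)
  also have "\<dots> = - (fps_X * fps_deriv G) * H + G * (S * H)" using assms(2) by (simp add: neg_logderiv_def)
  finally have "- (fps_X * fps_deriv G) * H = (T * G) * H"
    using assms(1) unfolding neg_logderiv_def by (simp only: algebra_simps) simp
  thus ?thesis using assms(3) unfolding neg_logderiv_def by (simp only: mult_cancel_right) simp
qed

text \<open>The expansion of \<open>n * X ^ n / (1 - X ^ n)\<close>.\<close>

definition divisor_fps :: "nat \<Rightarrow> complex fps" where
  "divisor_fps n = Abs_fps (\<lambda>m. if m > 0 \<and> n dvd m then of_nat n else 0)"

lemma neg_logderiv_one_minus_X_power:
  assumes "n > 0" shows "neg_logderiv (1 - fps_X ^ n) (divisor_fps n)"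
  unfolding neg_logderiv_def
proof (rule fps_ext)
  fix m
  have "fps_nth (- (fps_X * fps_deriv (1 - fps_X ^ n :: complex fps))) m = (if m = n then of_nat n else 0)"
    using assms by (auto simp: fps_nth_X_deriv fps_X_power_iff simp del: fps_deriv_sub fps_deriv_power)
  also have "\<dots> = fps_nth (divisor_fps n) m - (if m < n then 0 else fps_nth (divisor_fps n) (m - n))"
  proof (cases "m < n")
    case True thus ?thesis by (auto simp: divisor_fps_def dest: dvd_imp_le)
  next
    case False
    hence "n dvd m - n \<longleftrightarrow> n dvd m" by (simp add: dvd_minus_self)
    thus ?thesis using False assms by (auto simp: divisor_fps_def)
  qed
  also have "\<dots> = fps_nth (divisor_fps n * (1 - fps_X ^ n)) m"
    by (simp add: right_diff_distrib fps_X_power_mult_right_nth)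
  finally show "fps_nth (- (fps_X * fps_deriv (1 - fps_X ^ n))) m = fps_nth (divisor_fps n * (1 - fps_X ^ n)) m" .
qed

text \<open>A predicate on complex series, so that integral series and the factors
  \<open>1 - \<alpha> i * X\<close> live in one ring.\<close>

definition integral_fps :: "complex fps \<Rightarrow> bool" where
  "integral_fps G \<longleftrightarrow> (\<forall>m. fps_nth G m \<in> \<int>)"

lemma integral_fps_mult: "integral_fps G \<Longrightarrow> integral_fps H \<Longrightarrow> integral_fps (G * H)"
  by (auto simp: integral_fps_def fps_mult_nth intro!: Ints_sum Ints_mult)

text \<open>The witness is the integer power \<open>(1 - X ^ n) powi b\<close>, reached from
  \<open>b = 0\<close> by multiplying by \<open>1 - X ^ n\<close> or by its inverse.\<close>

lemma one_minus_X_power_factor: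
  fixes b :: int
  assumes n: "n > 0"
  shows "\<exists>P. integral_fps P \<and> fps_nth P 0 = 1 \<and> (\<forall>m. 0 < m \<longrightarrow> m < n \<longrightarrow> fps_nth P m = 0) \<and>
             fps_nth P n = - of_int b \<and> neg_logderiv P (fps_const (of_int b) * divisor_fps n)"
proof (induction b rule: int_induct[where k = 0])
  case base
  show ?case using n by (intro exI[of _ 1]) (auto simp: integral_fps_def neg_logderiv_def fps_one_nth)
next
  case (step1 b)
  then obtain P where P: "integral_fps P" "fps_nth P 0 = 1" "\<And>m. 0 < m \<Longrightarrow> m < n \<Longrightarrow> fps_nth P m = 0"
     "fps_nth P n = - of_int b" "neg_logderiv P (fps_const (of_int b) * divisor_fps n)" by blast
  have "integral_fps (1 - fps_X ^ n)" by (auto simp: integral_fps_def fps_X_power_iff fps_one_nth)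
  hence "integral_fps (P * (1 - fps_X ^ n))" using P(1) by (intro integral_fps_mult)
  moreover have "neg_logderiv (P * (1 - fps_X ^ n)) (fps_const (of_int b) * divisor_fps n + divisor_fps n)"
    by (intro neg_logderiv_mult P(5) neg_logderiv_one_minus_X_power n)
  hence "neg_logderiv (P * (1 - fps_X ^ n)) (fps_const (of_int (b + 1)) * divisor_fps n)"
    by (simp add: algebra_simps flip: fps_const_add)
  moreover have "fps_nth (P * (1 - fps_X ^ n)) m = fps_nth P m - (if m < n then 0 else fps_nth P (m - n))" for m
    by (simp add: right_diff_distrib fps_X_power_mult_right_nth)
  ultimately show ?case using P n by (intro exI[of _ "P * (1 - fps_X ^ n)"]) auto
next
  case (step2 b)
  then obtain P where P: "integral_fps P" "fps_nth P 0 = 1" "\<And>m. 0 < m \<Longrightarrow> m < n \<Longrightarrow> fps_nth P m = 0"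
     "fps_nth P n = - of_int b" "neg_logderiv P (fps_const (of_int b) * divisor_fps n)" by blast
  \<comment> \<open>The geometric series, inverse to \<open>1 - X ^ n\<close>.\<close>
  define E :: "complex fps" where "E = Abs_fps (\<lambda>m. if n dvd m then 1 else 0)"
  have "E * (1 - fps_X ^ n) = 1"
  proof (rule fps_ext)
    fix m
    have "n dvd m - n \<longleftrightarrow> n dvd m" if "\<not> m < n" using that by (simp add: dvd_minus_self)
    thus "fps_nth (E * (1 - fps_X ^ n)) m = fps_nth 1 m"
      using n by (auto simp: right_diff_distrib fps_X_power_mult_right_nth E_def fps_one_nth dest: dvd_imp_le)
  qed
  hence PE: "P * E * (1 - fps_X ^ n) = P" by (simp add: mult.assoc)
  have "integral_fps E" by (auto simp: integral_fps_def E_def)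
  hence "integral_fps (P * E)" using P(1) by (intro integral_fps_mult)
  moreover have "neg_logderiv (P * E * (1 - fps_X ^ n)) (fps_const (of_int (b - 1)) * divisor_fps n + divisor_fps n)"
    unfolding PE using P(5) by (simp add: algebra_simps flip: fps_const_sub)
  hence "neg_logderiv (P * E) (fps_const (of_int (b - 1)) * divisor_fps n)"
    by (rule neg_logderiv_cancel[OF _ neg_logderiv_one_minus_X_power[OF n]]) (use PE P(2) in force)
  moreover have rec: "fps_nth (P * E) m = fps_nth P m + (if m < n then 0 else fps_nth (P * E) (m - n))" for m
  proof -
    have "fps_nth P m = fps_nth (P * E * (1 - fps_X ^ n)) m" by (simp only: PE)
    also have "\<dots> = fps_nth (P * E) m - (if m < n then 0 else fps_nth (P * E) (m - n))"
      by (simp only: right_diff_distrib mult_1_right fps_sub_nth fps_X_power_mult_right_nth)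
    finally show ?thesis by simp
  qed
  moreover have "fps_nth (P * E) 0 = 1" using rec[of 0] P n by simp
  moreover have "fps_nth (P * E) n = - of_int (b - 1)" using rec[of n] \<open>fps_nth (P * E) 0 = 1\<close> P n by simp
  moreover have "fps_nth (P * E) m = 0" if "0 < m" "m < n" for m using rec[of m] P(3) that by simp
  ultimately show ?case by (intro exI[of _ "P * E"]) blast
qed

text \<open>The factors \<open>(1 - X ^ k) powi b k\<close> of \<open>G\<close> are split off one at a time; each contributes
  \<open>b k * divisor_fps k\<close> to the logarithmic derivative.\<close>

lemma integral_fps_peel:
  assumes "integral_fps G" "fps_nth G 0 = 1" "neg_logderiv G T"
  shows "\<exists>(b :: nat \<Rightarrow> int) H. integral_fps H \<and> fps_nth H 0 = 1 \<and> (\<forall>m. 0 < m \<longrightarrow> m \<le> N \<longrightarrow> fps_nth H m = 0) \<and>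
           neg_logderiv H (T - (\<Sum>k=1..N. fps_const (of_int (b k)) * divisor_fps k))"
proof (induction N)
  case 0
  show ?case using assms by (intro exI[of _ "\<lambda>_. 0"] exI[of _ G]) auto
next
  case (Suc N)
  then obtain b :: "nat \<Rightarrow> int" and H where H: "integral_fps H" "fps_nth H 0 = 1"
    "\<And>m. 0 < m \<Longrightarrow> m \<le> N \<Longrightarrow> fps_nth H m = 0"
    "neg_logderiv H (T - (\<Sum>k=1..N. fps_const (of_int (b k)) * divisor_fps k))" by blast
  obtain h where h: "fps_nth H (Suc N) = of_int h" using H(1) by (auto simp: integral_fps_def elim: Ints_cases)
  obtain P where P: "integral_fps P" "fps_nth P 0 = 1" "\<And>m. 0 < m \<Longrightarrow> m < Suc N \<Longrightarrow> fps_nth P m = 0"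
     "fps_nth P (Suc N) = - of_int h" "neg_logderiv P (fps_const (of_int h) * divisor_fps (Suc N))"
    using one_minus_X_power_factor[of "Suc N" h] by blast
  \<comment> \<open>\<open>P\<close> is the power of exponent \<open>h\<close>, whose coefficient
    \<open>- h\<close> cancels that of \<open>H\<close>; moving it to the other side gives
    \<open>G\<close> the exponent \<open>- h\<close>.\<close>
  define b' where "b' = b(Suc N := - h)"
  have "fps_nth (H * P) m = 0" if m: "0 < m" "m \<le> Suc N" for m
  proof -
    have "{0..m} = insert 0 (insert m {0<..<m})" using m by auto
    hence "fps_nth (H * P) m = fps_nth H 0 * fps_nth P m + fps_nth H m * fps_nth P 0 +
        (\<Sum>i\<in>{0<..<m}. fps_nth H i * fps_nth P (m - i))"
      using m by (simp add: fps_mult_nth)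
    also have "(\<Sum>i\<in>{0<..<m}. fps_nth H i * fps_nth P (m - i)) = 0"
      using H(3) m by (intro sum.neutral) auto
    also have "fps_nth H 0 * fps_nth P m + fps_nth H m * fps_nth P 0 + 0 = 0"
      using H P h m by (cases "m = Suc N") auto
    finally show ?thesis .
  qed
  moreover have "neg_logderiv (H * P) (T - (\<Sum>k=1..Suc N. fps_const (of_int (b' k)) * divisor_fps k))"
  proof -
    have "(\<Sum>k=1..N. fps_const (of_int (b' k)) * divisor_fps k) = (\<Sum>k=1..N. fps_const (of_int (b k)) * divisor_fps k)"
      by (intro sum.cong) (auto simp: b'_def)
    hence "T - (\<Sum>k=1..Suc N. fps_const (of_int (b' k)) * divisor_fps k) =
      (T - (\<Sum>k=1..N. fps_const (of_int (b k)) * divisor_fps k)) + fps_const (of_int h) * divisor_fps (Suc N)"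
      by (simp add: b'_def flip: fps_const_neg)
    thus ?thesis using neg_logderiv_mult[OF H(4) P(5)] by (simp only:)
  qed
  moreover have "integral_fps (H * P)" "fps_nth (H * P) 0 = 1" using H P by (auto intro: integral_fps_mult)
  ultimately show ?case by blast
qed

text \<open>After \<open>N\<close> factors are split off, the remaining series is 1 up to degree
  \<open>N\<close>, so its logarithmic derivative vanishes in the degrees 1 to \<open>N\<close>. The
  exponents \<open>b\<close> may depend on \<open>N\<close>.\<close>

lemma logderiv_coeffs_divisor_sum:
  assumes "integral_fps G" "fps_nth G 0 = 1" "neg_logderiv G T"
  shows "\<exists>b :: nat \<Rightarrow> int. \<forall>m. 0 < m \<longrightarrow> m \<le> N \<longrightarrow> fps_nth T m = of_int (\<Sum>k | k dvd m. int k * b k)"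
proof -
  obtain b :: "nat \<Rightarrow> int" and H where H: "fps_nth H 0 = 1" "\<And>m. 0 < m \<Longrightarrow> m \<le> N \<Longrightarrow> fps_nth H m = 0"
    "neg_logderiv H (T - (\<Sum>k=1..N. fps_const (of_int (b k)) * divisor_fps k))"
    using integral_fps_peel[OF assms, of N] by blast
  define S where "S = T - (\<Sum>k=1..N. fps_const (of_int (b k)) * divisor_fps k)"
  show ?thesis
  proof (intro exI[of _ b] allI impI)
    fix m assume m: "0 < m" "m \<le> N"
    have "0 = fps_nth (- (fps_X * fps_deriv H)) m" using H(2)[OF m] by (simp add: fps_nth_X_deriv)
    also have "\<dots> = fps_nth (S * H) m" using H(3) unfolding neg_logderiv_def S_def by simp
    also have "\<dots> = (\<Sum>i\<in>insert m {0..<m}. fps_nth S i * fps_nth H (m - i))"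
      unfolding fps_mult_nth by (intro sum.cong) auto
    also have "\<dots> = fps_nth S m + (\<Sum>i\<in>{0..<m}. fps_nth S i * fps_nth H (m - i))"
      using H(1) by (subst sum.insert) auto
    also have "(\<Sum>i\<in>{0..<m}. fps_nth S i * fps_nth H (m - i)) = 0"
      using H(2) m by (intro sum.neutral) auto
    finally have "fps_nth T m = (\<Sum>k=1..N. of_int (b k) * fps_nth (divisor_fps k) m)"
      by (simp add: S_def fps_sum_nth)
    also have "\<dots> = (\<Sum>k\<in>{1..N}. if k dvd m then of_int (int k * b k) else 0)"
      using m by (intro sum.cong refl) (auto simp: divisor_fps_def)
    also have "\<dots> = (\<Sum>k | k \<in> {1..N} \<and> k dvd m. of_int (int k * b k))"
      by (rule sum.inter_filter[symmetric]) simp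
    also have "{k. k \<in> {1..N} \<and> k dvd m} = {k. k dvd m}"
      using m by (auto dest: dvd_imp_le intro!: Suc_leI Nat.gr0I)
    finally show "fps_nth T m = of_int (\<Sum>k | k dvd m. int k * b k)" by simp
  qed
qed

text \<open>The series is \<open>a * X / (1 - a * X)\<close>, with constant term 0.\<close>

lemma neg_logderiv_linear:
  "neg_logderiv (1 - fps_const a * fps_X) (Abs_fps (\<lambda>m. if m = 0 then 0 else a ^ m))"
  unfolding neg_logderiv_def
proof (rule fps_ext)
  fix m
  let ?T = "Abs_fps (\<lambda>m. if m = 0 then 0 else a ^ m)"
  have "?T * (1 - fps_const a * fps_X) = ?T - fps_const a * (?T * fps_X)" by (simp add: algebra_simps)
  hence "fps_nth (?T * (1 - fps_const a * fps_X)) m = (if m = 1 then a else 0)"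
    by (cases m; cases "m - 1") auto
  also have "\<dots> = fps_nth (- (fps_X * fps_deriv (1 - fps_const a * fps_X))) m"
    unfolding fps_neg_nth fps_nth_X_deriv by (auto simp: fps_one_nth fps_X_def)
  finally show "fps_nth (- (fps_X * fps_deriv (1 - fps_const a * fps_X))) m = fps_nth (?T * (1 - fps_const a * fps_X)) m" ..
qed

text \<open>The reflected polynomial of \<open>C\<close> is the product of the
  \<open>1 - \<alpha> i * X\<close>: it is integral with constant term 1, and the power sums are the
  coefficients of its logarithmic derivative.\<close>

lemma power_sums_dold:
  fixes C :: "int poly" and \<alpha> :: "nat \<Rightarrow> complex" and A :: "nat \<Rightarrow> int"
  assumes C: "lead_coeff C = 1" "map_poly complex_of_int C = (\<Prod>i<d. [:- \<alpha> i, 1:])"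
    and A: "\<And>m. m > 0 \<Longrightarrow> complex_of_int (A m) = of_int v * (\<Sum>i<d. \<alpha> i ^ m)"
  shows "dold_condition A"
proof -
  define G where "G = (\<Prod>i<d. 1 - fps_const (\<alpha> i) * fps_X)"
  define T where "T = (\<Sum>i<d. Abs_fps (\<lambda>m. if m = 0 then 0 else \<alpha> i ^ m))"
  have "G = fps_of_poly (\<Prod>i<d. [:1, - \<alpha> i:])"
    unfolding G_def fps_of_poly_prod
    by (intro prod.cong refl) (simp add: fps_of_poly_pCons algebra_simps)
  also have "(\<Prod>i<d. [:1, - \<alpha> i:]) = (\<Prod>i<d. reflect_poly [:- \<alpha> i, 1:])"
    by (intro prod.cong refl) (auto simp: reflect_poly_def)
  also have "\<dots> = reflect_poly (map_poly complex_of_int C)"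
    by (simp add: C(2) reflect_poly_prod)
  finally have G: "G = fps_of_poly (reflect_poly (map_poly complex_of_int C))" .
  have "integral_fps G" unfolding G integral_fps_def
    by (auto simp: coeff_reflect_poly coeff_map_poly)
  moreover have "fps_nth G 0 = 1" unfolding G_def by (simp add: fps_prod_nth')
  moreover have "neg_logderiv G T" unfolding G_def T_def
    by (intro neg_logderiv_prod neg_logderiv_linear)
  ultimately have *: "\<exists>b :: nat \<Rightarrow> int. \<forall>m. 0 < m \<longrightarrow> m \<le> n \<longrightarrow> fps_nth T m = of_int (\<Sum>k | k dvd m. int k * b k)" for n
    by (rule logderiv_coeffs_divisor_sum)
  have T: "fps_nth T m = (\<Sum>i<d. \<alpha> i ^ m)" if "m > 0" for m
    using that by (simp add: T_def fps_sum_nth)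
  show ?thesis unfolding dold_condition_def
  proof (intro allI impI)
    fix n :: nat assume n: "n > 0"
    obtain b :: "nat \<Rightarrow> int" where b: "\<And>m. 0 < m \<Longrightarrow> m \<le> n \<Longrightarrow> fps_nth T m = of_int (\<Sum>k | k dvd m. int k * b k)"
      using * by blast
    show "int n dvd (\<Sum>d | d dvd n. moebius_mu d * A (n div d))"
    proof (rule dvd_moebius_sum_if_divisor_sum[OF n, of _ "\<lambda>k. v * b k"])
      fix m assume "m dvd n"
      hence m: "0 < m" "m \<le> n" using n by (auto intro: dvd_imp_le intro!: Nat.gr0I)
      have "complex_of_int (A m) = of_int (v * (\<Sum>k | k dvd m. int k * b k))"
        using A[OF m(1)] T[OF m(1)] b[OF m] by simp
      hence "A m = v * (\<Sum>k | k dvd m. int k * b k)" by (simp only: of_int_eq_iff)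
      thus "A m = (\<Sum>k | k dvd m. int k * (v * b k))" by (simp add: sum_distrib_left mult_ac)
    qed
  qed
qed

section \<open>Minimal polynomials over the integers\<close>

text \<open>Gauss's lemma: a primitive \<open>g\<close> of least degree vanishing at
  \<open>x\<close> divides a nonzero integer multiple \<open>a\<close> of a monic \<open>p\<close>.
  Comparing contents cancels \<open>a\<close>, so \<open>g\<close> divides \<open>p\<close> and has
  leading coefficient 1 or -1.\<close>

lemma algebraic_int_minimal_poly:
  assumes "algebraic_int (x :: complex)"
  obtains f where "lead_coeff f = 1" "degree f \<ge> 1" "cpoly f x = 0"
    "\<And>g. g \<noteq> 0 \<Longrightarrow> degree g < degree f \<Longrightarrow> cpoly g x \<noteq> 0"
proof -
  obtain p where p: "cpoly p x = 0" "lead_coeff p = 1"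
    using assms unfolding algebraic_int_altdef_ipoly by blast
  define Q where "Q = (\<lambda>n. \<exists>g. g \<noteq> 0 \<and> degree g = n \<and> cpoly g x = 0)"
  have "Q (degree p)" unfolding Q_def using p by (intro exI[of _ p]) auto
  hence "Q (LEAST n. Q n)" by (rule LeastI)
  then obtain g0 where g0: "g0 \<noteq> 0" "degree g0 = (LEAST n. Q n)" "cpoly g0 x = 0" by (auto simp: Q_def)
  define g where "g = primitive_part g0"
  have g: "g \<noteq> 0" "degree g = (LEAST n. Q n)" "content g = 1"
    using g0 by (auto simp: g_def)
  have "cpoly g0 x = of_int (content g0) * cpoly g x"
    unfolding g_def by (subst cpoly_smult[symmetric]) simp
  hence gx: "cpoly g x = 0" using g0 by auto
  have min: "cpoly h x \<noteq> 0" if "h \<noteq> 0" "degree h < degree g" for h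
    using not_less_Least[of "degree h" Q] that g by (auto simp: Q_def)
  obtain a q where aq: "a \<noteq> 0" "Polynomial.smult a p = g * q + pseudo_mod p g"
    using pseudo_mod(1)[OF g(1), of p] by blast
  have "cpoly (pseudo_mod p g) x = 0"
    using arg_cong[OF aq(2), of "\<lambda>r. cpoly r x"] p gx by (simp add: cpoly_smult cpoly_add cpoly_mult)
  hence "pseudo_mod p g = 0" using pseudo_mod(2)[OF g(1), of p] min by auto
  hence eq: "Polynomial.smult a p = g * q" using aq by simp
  have "content q = content (g * q)" by (simp add: content_mult g)
  also have "\<dots> = \<bar>a\<bar> * content p" unfolding eq[symmetric] by simp
  finally have "a dvd content q" by simp
  hence "[:a:] dvd q" by (simp add: const_poly_dvd_iff_dvd_content)
  then obtain q' where "q = [:a:] * q'" by blast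
  hence "Polynomial.smult a p = Polynomial.smult a (g * q')" using eq by simp
  hence "p = g * q'" using aq(1) by (metis smult_cancel)
  hence lc: "lead_coeff g * lead_coeff q' = 1" using p(2) by (simp add: lead_coeff_mult)
  have deg: "degree g \<ge> 1"
  proof (rule ccontr)
    assume "\<not> degree g \<ge> 1"
    then obtain c where "g = [:c:]" by (metis degree_eq_zeroE less_one not_le)
    thus False using gx g by simp
  qed
  from lc have "lead_coeff g = 1 \<or> lead_coeff g = - 1" by (auto simp: zmult_eq_1_iff)
  thus ?thesis
  proof
    assume "lead_coeff g = 1"
    thus ?thesis using deg gx min by (intro that[of g])
  next
    assume "lead_coeff g = - 1"
    moreover have "cpoly (- g) x = 0" using cpoly_smult[of "-1" g x] gx by simp
    ultimately show ?thesis using deg min by (intro that[of "- g"]) auto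
  qed
qed

text \<open>If \<open>f = a + X * s\<close> is the minimal polynomial, then
  \<open>x * s(x) = - a\<close>, and \<open>a\<close> is nonzero by minimality.\<close>

lemma algebraic_int_integer_multiple:
  assumes "algebraic_int (x :: complex)" "x \<noteq> 0"
  obtains s D where "D \<noteq> 0" "x * cpoly s x = of_int D"
proof -
  obtain f where f: "lead_coeff f = 1" "degree f \<ge> 1" "cpoly f x = 0"
    "\<And>g. g \<noteq> 0 \<Longrightarrow> degree g < degree f \<Longrightarrow> cpoly g x \<noteq> 0"
    using algebraic_int_minimal_poly[OF assms(1)] by blast
  obtain a s where s: "f = pCons a s" by (cases f)
  have s0: "s \<noteq> 0" using f(2) s by auto
  have eq: "of_int a + x * cpoly s x = 0" using f(3) unfolding s cpoly_pCons .
  have "a \<noteq> 0"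
  proof
    assume "a = 0"
    hence "cpoly s x = 0" using eq assms(2) by simp
    thus False using f(4)[OF s0] s s0 by simp
  qed
  thus ?thesis using eq by (intro that[of "- a" s]) (auto simp: add_eq_0_iff)
qed

text \<open>The minimal polynomial of \<open>x\<close> divides \<open>C\<close>; irreducibility
  makes the quotient constant.\<close>

lemma irreducible_poly_minimal:
  assumes irr: "irreducible (map_poly rat_of_int C)" and monic: "lead_coeff C = 1"
    and x: "cpoly C x = 0" and g: "g \<noteq> 0" "degree g < degree C"
  shows "cpoly g x \<noteq> 0"
proof -
  have "algebraic_int x" using x monic unfolding algebraic_int_altdef_ipoly by blast
  then obtain f where f: "lead_coeff f = 1" "degree f \<ge> 1" "cpoly f x = 0"
    "\<And>g. g \<noteq> 0 \<Longrightarrow> degree g < degree f \<Longrightarrow> cpoly g x \<noteq> 0"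
    using algebraic_int_minimal_poly by blast
  obtain q r where qr: "C = f * q + r" "r = 0 \<or> degree r < degree f"
    using monic_division[OF f(1)] by blast
  have "cpoly r x = 0" using x f(3) unfolding qr(1) by (simp add: cpoly_add cpoly_mult)
  hence "r = 0" using f(4) qr(2) by blast
  hence C: "C = f * q" using qr by simp
  hence "map_poly rat_of_int C = map_poly rat_of_int f * map_poly rat_of_int q"
    by (simp add: of_int_poly_hom.hom_mult)
  hence "is_unit (map_poly rat_of_int f) \<or> is_unit (map_poly rat_of_int q)"
    using irr irreducibleD by blast
  hence "degree f = 0 \<or> degree q = 0" by (auto simp: is_unit_poly_iff degree_map_poly dest!: arg_cong[of _ _ degree])
  hence "degree q = 0" using f(2) by simp
  moreover have "q \<noteq> 0" "f \<noteq> 0" using C monic by auto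
  ultimately have "degree C = degree f" using C by (simp add: degree_mult_eq)
  thus ?thesis using f(4) g by simp
qed

text \<open>The remainder of \<open>q\<close> modulo \<open>C\<close> vanishes at \<open>x\<close>,
  hence is zero. This transfer of integral relations between roots takes the place of Galois
  automorphisms.\<close>

lemma irreducible_poly_roots_conjugate:
  assumes irr: "irreducible (map_poly rat_of_int C)" and monic: "lead_coeff C = 1"
    and x: "cpoly C x = 0" and y: "cpoly C y = 0" and q: "cpoly q x = 0"
  shows "cpoly q y = 0"
proof -
  obtain s r where sr: "q = C * s + r" "r = 0 \<or> degree r < degree C"
    using monic_division[OF monic] by blast
  have "cpoly r x = 0" using x q unfolding sr(1) by (simp add: cpoly_add cpoly_mult)
  hence "r = 0" using irreducible_poly_minimal[OF irr monic x, of r] sr(2) by blast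
  thus ?thesis using y sr(1) by (simp add: cpoly_mult)
qed

section \<open>Elements fixed by the Frobenius map\<close>

text \<open>Lagrange's theorem modulo \<open>p\<close>: after splitting off \<open>X - s\<close>,
  the quotient still vanishes modulo \<open>p\<close> at the other points, as \<open>p\<close> does
  not divide \<open>t - s\<close>.\<close>

lemma dvd_coeffs_if_many_roots:
  fixes q :: "int poly"
  assumes p: "prime p" and "finite S" and "\<And>s s'. s \<in> S \<Longrightarrow> s' \<in> S \<Longrightarrow> s \<noteq> s' \<Longrightarrow> \<not> p dvd s - s'"
    and "degree q < card S" and "\<And>s. s \<in> S \<Longrightarrow> p dvd poly q s"
  shows "p dvd coeff q i"
  using assms(2-)
proof (induction S arbitrary: q i rule: finite_induct)
  case (insert s S)
  define q1 where "q1 = synthetic_div q s"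
  have q: "q = [:- s, 1:] * q1 + [:poly q s:]" unfolding q1_def by (rule synthetic_div_correct'[symmetric])
  have ps: "p dvd poly q s" using insert.prems by simp
  have q1: "p dvd coeff q1 j" for j
  proof (cases "degree q = 0")
    case True
    hence "q1 = 0" using synthetic_div_eq_0_iff[of q s] by (simp add: q1_def)
    thus ?thesis by simp
  next
    case False
    show ?thesis
    proof (rule insert.IH)
      show "degree q1 < card S"
        using insert.prems(2) insert.hyps False by (simp add: q1_def degree_synthetic_div)
      fix t assume t: "t \<in> S"
      have "poly q t - poly q s = (t - s) * poly q1 t" by (subst (1) q) (simp add: algebra_simps)
      moreover have "p dvd poly q t - poly q s" using insert.prems(3) t by (intro dvd_diff) auto
      moreover have "\<not> p dvd t - s" using insert.prems(1)[of t s] insert.hyps t by auto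
      ultimately show "p dvd poly q1 t" using p by (metis prime_dvd_multD)
    qed (use insert.prems in auto)
  qed
  show ?case
    by (subst q) (use q1 ps in \<open>auto simp: coeff_pCons split: nat.splits intro!: dvd_add dvd_mult dvd_diff\<close>)
qed simp

lemma alg_cong_power: 
  assumes "algebraic_int x" "algebraic_int y" "alg_cong p x y" shows "alg_cong p (x ^ n) (y ^ n)"
  using assms by (induction n) (auto intro!: alg_cong_mult)

lemma fermat_int:
  assumes "prime p" shows "int p dvd x ^ p - x"
proof -
  have nat: "alg_cong p (of_nat n ^ p) (of_nat n)" for n
  proof (induction n)
    case 0
    thus ?case using prime_gt_0_nat[OF assms] by (simp add: power_0_left)
  next
    case (Suc n)
    have "alg_cong p ((1 + of_nat n) ^ p) (1 ^ p + of_nat n ^ p)"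
      by (intro alg_cong_add_power_prime assms) auto
    also have "alg_cong p \<dots> (1 + of_nat n)" using Suc.IH by (intro alg_cong_add) auto
    finally show ?case by simp
  qed
  have p0: "p > 0" using assms prime_gt_0_nat by blast
  define n where "n = nat (x mod int p)"
  have n: "(of_nat n :: complex) = of_int (x mod int p)" using p0 by (simp add: n_def)
  have xn: "alg_cong p (of_int x) (of_nat n)"
    unfolding n by (rule alg_cong_of_int) (simp add: minus_mod_eq_mult_div)
  have "alg_cong p (of_int x ^ p) (of_nat n ^ p)" by (intro alg_cong_power xn) auto
  also note nat
  also note alg_cong_sym[OF xn]
  finally have "alg_cong p (of_int (x ^ p - x)) 0" unfolding alg_cong_0_iff_diff[of p "of_int x ^ p"] by simp
  thus ?thesis using p0 by (rule alg_cong_of_intD)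
qed

lemma alg_cong_cpoly_0:
  assumes "\<And>i. int p dvd coeff q i" "algebraic_int x" shows "alg_cong p (cpoly q x) 0"
proof -
  have "alg_cong p (\<Sum>i\<le>degree q. x ^ i * of_int (coeff q i)) (\<Sum>i\<le>degree q. x ^ i * of_int 0)"
    by (intro alg_cong_sum alg_cong_mult_left alg_cong_of_int) (use assms in auto)
  thus ?thesis by (simp add: cpoly_altdef mult.commute)
qed

text \<open>\<open>X ^ p - X\<close> and the product of all \<open>X - b\<close> differ by a
  polynomial of degree below \<open>p\<close> with \<open>p\<close> roots modulo \<open>p\<close>,
  so \<open>p\<close> divides all its coefficients.\<close>

lemma alg_cong_prod_residues:
  assumes p: "prime p" and x: "algebraic_int x"
  shows "alg_cong p (x ^ p - x) (\<Prod>b\<in>{0..<int p}. x - of_int b)"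
proof -
  define R :: "int poly" where "R = (\<Prod>b\<in>{0..<int p}. [:- b, 1:])"
  define q where "q = monom 1 p - [:0, 1:] - R"
  have p2: "p \<ge> 2" using p prime_ge_2_nat by blast
  have degR: "degree R = p" unfolding R_def by (subst degree_prod_eq_sum_degree) auto
  have lcR: "lead_coeff R = 1" unfolding R_def by (simp add: lead_coeff_prod)
  have "degree q < p"
  proof -
    have "degree q \<le> p" unfolding q_def using p2 degR
      by (intro degree_diff_le) (auto simp: degree_monom_eq)
    moreover have "coeff q p = 0"
      using p2 lcR degR unfolding q_def by (simp add: coeff_pCons split: nat.splits)
    hence "degree q \<noteq> p \<or> q = 0" by auto
    ultimately show ?thesis using p2 by auto
  qed
  have "int p dvd coeff q i" for i
  proof (rule dvd_coeffs_if_many_roots[of _ "{0..<int p}"])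
    show "prime (int p)" using p by simp
    show "degree q < card {0..<int p}" using \<open>degree q < p\<close> by simp
  next
    fix s assume "s \<in> {0..<int p}"
    hence "poly R s = 0" unfolding R_def by (auto simp: poly_prod)
    thus "int p dvd poly q s" using fermat_int[OF p, of s] by (simp add: q_def poly_monom)
  next
    fix s s' assume "s \<in> {0..<int p}" "s' \<in> {0..<int p}" "s \<noteq> s'"
    thus "\<not> int p dvd s - s'" using dvd_imp_le_int[of "s - s'" "int p"] by auto
  qed auto
  hence "alg_cong p (cpoly q x) 0" using x by (rule alg_cong_cpoly_0)
  also have "cpoly q x = (x ^ p - x) - cpoly R x" by (simp add: q_def cpoly_diff poly_monom)
  also have "cpoly R x = (\<Prod>b\<in>{0..<int p}. x - of_int b)"
    unfolding R_def by (simp add: of_int_poly_hom.hom_prod poly_prod)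
  finally show ?thesis using alg_cong_0_iff_diff by blast
qed

text \<open>If \<open>b\<close> is not a root of \<open>f\<close> modulo \<open>p\<close>, then \<open>x - b\<close> divides \<open>f b\<close> and hence is invertible modulo \<open>p\<close>.\<close>

lemma frobenius_fixed_single_root:
  assumes p: "prime p" and x: "algebraic_int x" "cpoly f x = 0" "alg_cong p (x ^ p) x"
    and a: "\<And>b. int p dvd poly f b \<Longrightarrow> int p dvd b - a"
  shows "alg_cong p x (of_int a)"
proof -
  have p0: "p > 0" using p prime_gt_0_nat by blast
  define a' where "a' = a mod int p"
  define B where "B = {0..<int p} - {a'}"
  have a': "a' \<in> {0..<int p}" using p0 by (simp add: a'_def)
  \<comment> \<open>The value at \<open>x\<close> of \<open>(f - f b) / (X - b)\<close>; as
    \<open>f\<close> vanishes at \<open>x\<close>, it is a cofactor of \<open>x - b\<close> in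
    \<open>- f b\<close>.\<close>
  define g where "g = (\<lambda>b. cpoly (synthetic_div f b) x)"
  have g: "(x - of_int b) * g b = of_int (- poly f b)" for b
  proof -
    have "0 = cpoly ([:- b, 1:] * synthetic_div f b + [:poly f b:]) x"
      unfolding synthetic_div_correct' by (simp add: x(2))
    also have "\<dots> = (x - of_int b) * g b + of_int (poly f b)"
      by (simp add: cpoly_add cpoly_mult cpoly_pCons g_def del: mult_pCons_left)
    finally show ?thesis by (simp add: eq_neg_iff_add_eq_0)
  qed
  have "alg_cong p (\<Prod>b\<in>{0..<int p}. x - of_int b) (x ^ p - x)"
    by (rule alg_cong_sym, rule alg_cong_prod_residues[OF p x(1)])
  also have "alg_cong p (x ^ p - x) 0" using x(3) alg_cong_0_iff_diff by blast
  finally have "alg_cong p (\<Prod>b\<in>{0..<int p}. x - of_int b) 0" .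
  hence "alg_cong p ((\<Prod>b\<in>B. g b) * (\<Prod>b\<in>{0..<int p}. x - of_int b)) ((\<Prod>b\<in>B. g b) * 0)"
    by (rule alg_cong_mult_left[rotated]) (unfold g_def, intro algebraic_int_prod algebraic_int_cpoly x(1))
  also have "(\<Prod>b\<in>{0..<int p}. x - of_int b) = (x - of_int a') * (\<Prod>b\<in>B. x - of_int b)"
    unfolding B_def using a' by (intro prod.remove) auto
  also have "(\<Prod>b\<in>B. g b) * ((x - of_int a') * (\<Prod>b\<in>B. x - of_int b)) = (\<Prod>b\<in>B. (x - of_int b) * g b) * (x - of_int a')"
    by (simp add: prod.distrib mult_ac)
  also have "\<dots> = of_int (\<Prod>b\<in>B. - poly f b) * (x - of_int a')" unfolding g by simp
  finally have "alg_cong p (of_int (\<Prod>b\<in>B. - poly f b) * (x - of_int a')) 0" by simp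
  moreover have "coprime (\<Prod>b\<in>B. - poly f b) (int p)"
  proof (rule prod_coprime_left)
    fix b assume b: "b \<in> B"
    have "\<not> int p dvd poly f b"
    proof
      assume "int p dvd poly f b"
      hence "int p dvd b - a" by (rule a)
      hence "b mod int p = a'" by (simp add: a'_def mod_eq_dvd_iff)
      thus False using b by (auto simp: B_def)
    qed
    hence "coprime (int p) (poly f b)" using p by (intro prime_imp_coprime) auto
    thus "coprime (- poly f b) (int p)" by (simp add: coprime_commute)
  qed
  ultimately have "alg_cong p (x - of_int a') 0"
    by (rule alg_cong_0_cancel_int) (use x(1) in auto)
  hence "alg_cong p x (of_int a')" using alg_cong_0_iff_diff by blast
  also have "alg_cong p (of_int a') (of_int a)"
    by (rule alg_cong_of_int) (simp add: a'_def mod_eq_dvd_iff[symmetric])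
  finally show ?thesis .
qed

section \<open>Linear recurrences with irreducible characteristic polynomial\<close>

text \<open>The coefficients of \<open>(p(X) - p(y)) / (X - y)\<close> are integer polynomials in
  \<open>y\<close>, the same for all \<open>y\<close>, so they can serve all conjugates at
  once.\<close>

lemma synthetic_div_coeff_cpoly:
  "\<exists>K. \<forall>y n. coeff (synthetic_div (map_poly complex_of_int p) y) n = cpoly (K n) y"
proof (induction p)
  case 0
  show ?case by (intro exI[of _ "\<lambda>_. 0"]) simp
next
  case (pCons a p)
  then obtain K where K: "\<And>y n. coeff (synthetic_div (map_poly complex_of_int p) y) n = cpoly (K n) y"
    by blast
  show ?case
    by (intro exI[of _ "\<lambda>n. case n of 0 \<Rightarrow> p | Suc m \<Rightarrow> K m"])
       (auto simp: of_int_hom.map_poly_pCons_hom coeff_pCons K split: nat.splits)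
qed

lemma cpoly_pcompose: "cpoly (pcompose f h) x = cpoly f (cpoly h x)"
  by (induction f) (simp_all add: pcompose_pCons cpoly_add cpoly_mult cpoly_pCons)

locale irreducible_recurrence =
  fixes d :: nat and C :: "int poly" and U :: "nat \<Rightarrow> int" and \<alpha> l :: "nat \<Rightarrow> complex"
  assumes d: "d \<ge> 1"
    and irr: "irreducible (map_poly rat_of_int C)"
    and C_eq: "map_poly complex_of_int C = (\<Prod>i<d. [:- \<alpha> i, 1:])"
    and U: "\<And>n. complex_of_int (U n) = (\<Sum>i<d. l i * \<alpha> i ^ n)"
begin

lemma degree_C: "degree C = d"
proof -
  have "degree C = degree (map_poly complex_of_int C)" by (simp add: degree_map_poly)
  also have "\<dots> = d" unfolding C_eq by (subst degree_prod_eq_sum_degree) auto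
  finally show ?thesis .
qed

lemma monic_C: "lead_coeff C = 1"
proof -
  have "complex_of_int (lead_coeff C) = lead_coeff (map_poly complex_of_int C)"
    by (simp add: degree_map_poly coeff_map_poly)
  also have "\<dots> = 1" unfolding C_eq by (simp add: lead_coeff_prod)
  finally show ?thesis by simp
qed

lemma root_C: "i < d \<Longrightarrow> cpoly C (\<alpha> i) = 0"
  unfolding C_eq by (auto simp: poly_prod)

lemma algebraic_int_\<alpha>: "i < d \<Longrightarrow> algebraic_int (\<alpha> i)"
  using root_C monic_C unfolding algebraic_int_altdef_ipoly by blast

lemma conjugate:
  assumes "i < d" "j < d" "cpoly q (\<alpha> i) = 0" shows "cpoly q (\<alpha> j) = 0"
  using irreducible_poly_roots_conjugate[OF irr monic_C root_C[OF assms(1)] root_C[OF assms(2)] assms(3)] .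

text \<open>A relation found at \<open>\<alpha> 0\<close> passes to all roots by conjugacy. It makes
  the values of \<open>q\<close> invertible modulo every prime not dividing
  \<open>D\<close>.\<close>

lemma integer_multiple:
  assumes "cpoly q (\<alpha> 0) \<noteq> 0"
  obtains V D where "D \<noteq> 0" "\<And>i. i < d \<Longrightarrow> cpoly V (\<alpha> i) * cpoly q (\<alpha> i) = of_int D"
proof -
  have "algebraic_int (cpoly q (\<alpha> 0))" using algebraic_int_\<alpha>[of 0] d by auto
  then obtain s D where s: "D \<noteq> 0" "cpoly q (\<alpha> 0) * cpoly s (cpoly q (\<alpha> 0)) = of_int D"
    by (rule algebraic_int_integer_multiple[OF _ assms])
  define V where "V = pcompose s q"
  have z: "cpoly (V * q - [:D:]) (\<alpha> 0) = 0"
    using s by (simp add: V_def cpoly_diff cpoly_mult cpoly_pcompose cpoly_pCons mult.commute)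
  have zi: "cpoly (V * q - [:D:]) (\<alpha> i) = 0" if "i < d" for i
    by (rule conjugate[OF _ that z]) (use d in simp)
  show ?thesis
  proof (rule that[OF s(1)])
    show "cpoly V (\<alpha> i) * cpoly q (\<alpha> i) = of_int D" if "i < d" for i
      using zi[OF that] unfolding cpoly_diff cpoly_mult cpoly_pCons by simp
  qed
qed

lemma cofactor_eq_synthetic_div:
  assumes "i < d"
  shows "(\<Prod>j\<in>{..<d} - {i}. [:- \<alpha> j, 1:]) = synthetic_div (map_poly complex_of_int C) (\<alpha> i)"
proof -
  have "[:- \<alpha> i, 1:] * (\<Prod>j\<in>{..<d} - {i}. [:- \<alpha> j, 1:]) = map_poly complex_of_int C"
    unfolding C_eq by (rule prod.remove[symmetric]) (use assms in auto)
  also have "\<dots> = [:- \<alpha> i, 1:] * synthetic_div (map_poly complex_of_int C) (\<alpha> i)"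
    using synthetic_div_correct'[of "\<alpha> i" "map_poly complex_of_int C"] root_C[OF assms] by simp
  finally show ?thesis by (simp only: mult_cancel_left) simp
qed

lemma pderiv_C_root:
  assumes "i < d"
  shows "cpoly (pderiv C) (\<alpha> i) = (\<Prod>j\<in>{..<d} - {i}. \<alpha> i - \<alpha> j)"
proof -
  have "map_poly complex_of_int (pderiv C) = pderiv (map_poly complex_of_int C)"
    by (simp add: of_int_hom.map_poly_pderiv)
  also have "\<dots> = (\<Sum>a<d. (\<Prod>j\<in>{..<d} - {a}. [:- \<alpha> j, 1:]))"
    unfolding C_eq pderiv_prod by (simp add: pderiv_pCons)
  finally have "cpoly (pderiv C) (\<alpha> i) = (\<Sum>a<d. \<Prod>j\<in>{..<d} - {a}. \<alpha> i - \<alpha> j)"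
    by (simp add: poly_sum poly_prod)
  also have "\<dots> = (\<Sum>a<d. if a = i then \<Prod>j\<in>{..<d} - {i}. \<alpha> i - \<alpha> j else 0)"
    using assms by (intro sum.cong) auto
  also have "\<dots> = (\<Prod>j\<in>{..<d} - {i}. \<alpha> i - \<alpha> j)" using assms by simp
  finally show ?thesis .
qed

text \<open>Lagrange interpolation expresses \<open>l i * C' (\<alpha> i)\<close> by the values \<open>U 0, \<dots>, U (d - 1)\<close>.\<close>

lemma coefficients_times_derivative:
  obtains H where "\<And>i. i < d \<Longrightarrow> l i * cpoly (pderiv C) (\<alpha> i) = cpoly H (\<alpha> i)"
proof -
  obtain K where K: "\<And>y n. coeff (synthetic_div (map_poly complex_of_int C) y) n = cpoly (K n) y"
    using synthetic_div_coeff_cpoly by metis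
  define H where "H = (\<Sum>n<d. Polynomial.smult (U n) (K n))"
  show ?thesis
  proof (rule that[of H])
    fix i assume i: "i < d"
    define L where "L = (\<Prod>j\<in>{..<d} - {i}. [:- \<alpha> j, 1:])"
    have "degree L < d" unfolding L_def using i by (subst degree_prod_eq_sum_degree) auto
    hence L: "poly L x = (\<Sum>n<d. coeff L n * x ^ n)" for x
      unfolding poly_altdef by (intro sum.mono_neutral_left) (auto simp: coeff_eq_0)
    have "cpoly H (\<alpha> i) = (\<Sum>n<d. of_int (U n) * coeff L n)"
      by (simp add: H_def cpoly_sum cpoly_smult K[symmetric] L_def cofactor_eq_synthetic_div[OF i])
    also have "\<dots> = (\<Sum>n<d. \<Sum>j<d. l j * (coeff L n * \<alpha> j ^ n))"
      by (simp add: U sum_distrib_left mult_ac)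
    also have "\<dots> = (\<Sum>j<d. l j * poly L (\<alpha> j))"
      unfolding L by (subst sum.swap) (simp add: sum_distrib_left)
    also have "\<dots> = (\<Sum>j<d. if j = i then l i * (\<Prod>j\<in>{..<d} - {i}. \<alpha> i - \<alpha> j) else 0)"
      by (intro sum.cong refl) (auto simp: L_def poly_prod)
    also have "\<dots> = l i * cpoly (pderiv C) (\<alpha> i)" using i pderiv_C_root[OF i] by simp
    finally show "l i * cpoly (pderiv C) (\<alpha> i) = cpoly H (\<alpha> i)" ..
  qed
qed

text \<open>Separability: the derivative has smaller degree than the minimal polynomial
  \<open>C\<close>.\<close>

lemma derivative_nonzero: "cpoly (pderiv C) (\<alpha> 0) \<noteq> 0"
proof (rule irreducible_poly_minimal[OF irr monic_C root_C])
  show "pderiv C \<noteq> 0" using degree_C d by (simp add: pderiv_eq_0_iff)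
  show "degree (pderiv C) < degree C" using degree_C d by (simp add: degree_pderiv)
qed (use d in auto)

text \<open>With \<open>m j = D * l j\<close>, the weights \<open>c * (m j ^ p - m j)\<close> have
  power sums at the nodes \<open>\<alpha> j ^ p\<close> that vanish modulo \<open>p\<close>.
  Lagrange interpolation isolates one weight, up to factors invertible modulo large
  \<open>p\<close>.\<close>

lemma frobenius_fixes_coefficients:
  assumes "d \<ge> 2" and c: "c > 0" "dold_condition (\<lambda>n. int c * U n)"
    and D: "D \<noteq> 0" "\<And>i. i < d \<Longrightarrow> cpoly V (\<alpha> i) * cpoly (pderiv C) (\<alpha> i) = of_int D"
    and h: "\<And>i. i < d \<Longrightarrow> of_int D * l i = cpoly h (\<alpha> i)"
  obtains w :: nat where
    "\<And>p i. prime p \<Longrightarrow> p > w \<Longrightarrow> i < d \<Longrightarrow> alg_cong p ((of_int D * l i) ^ p) (of_int D * l i)"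
proof -
  \<comment> \<open>The roots are nonzero because \<open>d \<ge> 2\<close>, so \<open>Z\<close>
    inverts them up to the integer \<open>E\<close>.\<close>
  have "cpoly [:0, 1:] (\<alpha> 0) \<noteq> 0"
    by (rule irreducible_poly_minimal[OF irr monic_C root_C]) (use degree_C assms(1) in auto)
  then obtain Z E where "E \<noteq> 0" "\<And>i. i < d \<Longrightarrow> cpoly Z (\<alpha> i) * cpoly [:0, 1:] (\<alpha> i) = of_int E"
    by (rule integer_multiple) (rule that)
  hence E: "E \<noteq> 0" "\<And>i. i < d \<Longrightarrow> cpoly Z (\<alpha> i) * \<alpha> i = of_int E" by (auto simp: cpoly_pCons)
  define m where "m = (\<lambda>i. of_int D * l i)"
  have m: "algebraic_int (m i)" if "i < d" for i
    unfolding m_def h[OF that] using algebraic_int_\<alpha>[OF that] by auto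
  \<comment> \<open>Primes above \<open>w\<close> are odd, do not divide \<open>c\<close>,
    \<open>D\<close> or \<open>E\<close>, and exceed all exponents \<open>n \<le> d\<close>.\<close>
  define w where "w = d + c + nat \<bar>D\<bar> + nat \<bar>E\<bar> + 2"
  show ?thesis
  proof (rule that[of w])
    fix p i assume p: "prime p" "p > w" and i: "i < d"
    have p0: "p > 0" using p by simp
    have odd: "odd p" using p prime_odd_nat[of p] by (simp add: w_def)
    have cop: "coprime a (int p)" if "a \<noteq> 0" "\<bar>a\<bar> \<le> int w" for a
    proof -
      have "\<not> int p dvd a" using dvd_imp_le_int[OF that(1), of "int p"] that(2) p(2) by auto
      hence "coprime (int p) a" using p(1) by (intro prime_imp_coprime) auto
      thus ?thesis by (simp add: coprime_commute)
    qed
    have copc: "coprime (int c) (int p)" by (rule cop) (use c(1) in \<open>auto simp: w_def\<close>)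
    have copD: "coprime D (int p)" by (rule cop) (use D(1) in \<open>auto simp: w_def\<close>)
    have copE: "coprime E (int p)" by (rule cop) (use E(1) in \<open>auto simp: w_def\<close>)
    define \<delta> where "\<delta> = (\<lambda>j. of_nat c * (m j ^ p - m j))"
    define y where "y = (\<lambda>j. \<alpha> j ^ p)"
    have y: "algebraic_int (y j)" if "j < d" for j unfolding y_def using algebraic_int_\<alpha>[OF that] by auto
    have \<delta>: "algebraic_int (\<delta> j)" if "j < d" for j unfolding \<delta>_def using m[OF that] by auto

    \<comment> \<open>\<open>u ^ p\<close> is congruent to
      \<open>\<Sum>j<d. m j ^ p * y j ^ n\<close> by the binomial theorem and to \<open>u\<close> by
      Fermat, while \<open>\<Sum>j<d. m j * y j ^ n\<close> equals \<open>D * U (p * n)\<close>,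
      which the Dold condition compares with \<open>u\<close> after multiplication by
      \<open>c\<close>.\<close>
    have power_sum: "alg_cong p (\<Sum>j<d. \<delta> j * y j ^ n) 0" if n: "n \<ge> 1" "n \<le> d" for n
    proof -
      have "\<not> p dvd n" using n p(2) by (auto simp: w_def dest: dvd_imp_le)
      with dold_condition_prime_cong[OF c(2) p(1), of n] n
      have dvd1: "int p dvd int c * U (p * n) - int c * U n" by simp
      define u where "u = D * U n"
      have u: "of_int u = (\<Sum>j<d. m j * \<alpha> j ^ n)"
        by (simp add: u_def U m_def sum_distrib_left mult_ac)
      have "alg_cong p (\<Sum>j<d. m j ^ p * y j ^ n) (of_int u ^ p)"
      proof -
        have "alg_cong p ((\<Sum>j<d. m j * \<alpha> j ^ n) ^ p) (\<Sum>j<d. (m j * \<alpha> j ^ n) ^ p)"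
          by (rule alg_cong_sum_power_prime[OF p(1)]) (auto intro: m algebraic_int_\<alpha>)
        also have "(\<Sum>j<d. (m j * \<alpha> j ^ n) ^ p) = (\<Sum>j<d. m j ^ p * y j ^ n)"
          by (simp add: y_def power_mult_distrib mult.commute flip: power_mult)
        finally show ?thesis unfolding u by (rule alg_cong_sym)
      qed
      hence "alg_cong p (of_nat c * (\<Sum>j<d. m j ^ p * y j ^ n)) (of_nat c * of_int u ^ p)"
        by (rule alg_cong_mult_left[rotated]) auto
      hence "alg_cong p (of_nat c * (\<Sum>j<d. m j ^ p * y j ^ n) - of_nat c * (\<Sum>j<d. m j * y j ^ n))
               (of_nat c * of_int u ^ p - of_nat c * (\<Sum>j<d. m j * y j ^ n))"
        by (rule alg_cong_diff) simp
      also have "of_nat c * (\<Sum>j<d. m j ^ p * y j ^ n) - of_nat c * (\<Sum>j<d. m j * y j ^ n) = (\<Sum>j<d. \<delta> j * y j ^ n)"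
        by (simp add: \<delta>_def sum_distrib_left algebra_simps sum_subtractf)
      also have "(\<Sum>j<d. m j * y j ^ n) = of_int (D * U (p * n))"
        by (simp add: U m_def y_def sum_distrib_left mult_ac flip: power_mult)
      also have "of_nat c * of_int u ^ p - of_nat c * of_int (D * U (p * n)) = 
                 complex_of_int (int c * u ^ p - int c * (D * U (p * n)))" by simp
      also have "alg_cong p \<dots> (of_int 0)"
      proof (rule alg_cong_of_int)
        have "int p dvd int c * (u ^ p - u)" using fermat_int[OF p(1), of u] by simp
        moreover have "int p dvd D * (int c * U (p * n) - int c * U n)" using dvd1 by simp
        ultimately have "int p dvd int c * (u ^ p - u) - D * (int c * U (p * n) - int c * U n)" by (rule dvd_diff)
        thus "int p dvd int c * u ^ p - int c * (D * U (p * n)) - 0" by (simp add: u_def algebra_simps)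
      qed
      finally show ?thesis by simp
    qed

    define L where "L = (\<Prod>j\<in>{..<d} - {i}. [:- y j, 1:])"
    have degL: "degree L < d" unfolding L_def using i by (subst degree_prod_eq_sum_degree) auto
    have coeffL: "algebraic_int (coeff L n)" for n
      unfolding L_def by (rule algebraic_int_coeff_prod_linear) (auto intro: y)
    have L: "poly L x = (\<Sum>n<d. coeff L n * x ^ n)" for x
      unfolding poly_altdef by (intro sum.mono_neutral_left) (use degL in \<open>auto simp: coeff_eq_0\<close>)
    \<comment> \<open>The congruences start at exponent 1, so the exponents are shifted to
      \<open>Suc n\<close>; this costs the extra factor \<open>y i\<close>.\<close>
    have "alg_cong p (\<Sum>n<d. coeff L n * (\<Sum>j<d. \<delta> j * y j ^ Suc n)) (\<Sum>n<d. coeff L n * 0)"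
      by (intro alg_cong_sum alg_cong_mult_left coeffL power_sum) auto
    also have "(\<Sum>n<d. coeff L n * (\<Sum>j<d. \<delta> j * y j ^ Suc n)) = (\<Sum>j<d. \<delta> j * y j * poly L (y j))"
      unfolding L sum_distrib_left by (subst sum.swap) (simp add: mult_ac)
    also have "\<dots> = (\<Sum>j<d. if j = i then \<delta> i * y i * (\<Prod>j\<in>{..<d} - {i}. y i - y j) else 0)"
      by (intro sum.cong refl) (auto simp: L_def poly_prod)
    also have "\<dots> = (\<delta> i * y i) * (\<Prod>j\<in>{..<d} - {i}. y i - y j)" using i by simp
    finally have 1: "alg_cong p ((\<delta> i * y i) * (\<Prod>j\<in>{..<d} - {i}. y i - y j)) 0" by simp
    \<comment> \<open>Additivity of the \<open>p\<close>-th power replaces the Vandermonde factor by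
      the \<open>p\<close>-th power of the derivative at \<open>\<alpha> i\<close>, which
      \<open>V\<close> inverts up to \<open>D\<close>.\<close>
    have "alg_cong p (\<Prod>j\<in>{..<d} - {i}. (\<alpha> i - \<alpha> j) ^ p) (\<Prod>j\<in>{..<d} - {i}. y i - y j)"
      unfolding y_def
      by (intro alg_cong_prod alg_cong_diff_power_prime p(1) odd) (use i in \<open>auto intro!: algebraic_int_\<alpha>\<close>)
    hence "alg_cong p (cpoly (pderiv C) (\<alpha> i) ^ p) (\<Prod>j\<in>{..<d} - {i}. y i - y j)"
      unfolding pderiv_C_root[OF i] by (simp add: prod_power_distrib)
    hence "alg_cong p ((\<delta> i * y i) * cpoly (pderiv C) (\<alpha> i) ^ p) ((\<delta> i * y i) * (\<Prod>j\<in>{..<d} - {i}. y i - y j))"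
      by (rule alg_cong_mult_left[rotated]) (use \<delta>[OF i] y[OF i] in auto)
    from alg_cong_trans[OF this 1]
    have "alg_cong p ((\<delta> i * y i) * cpoly (pderiv C) (\<alpha> i) ^ p) 0" .
    hence "alg_cong p ((cpoly V (\<alpha> i) * cpoly Z (\<alpha> i)) ^ p * ((\<delta> i * y i) * cpoly (pderiv C) (\<alpha> i) ^ p))
             ((cpoly V (\<alpha> i) * cpoly Z (\<alpha> i)) ^ p * 0)"
      by (rule alg_cong_mult_left[rotated]) (use algebraic_int_\<alpha>[OF i] in auto)
    also have "(cpoly V (\<alpha> i) * cpoly Z (\<alpha> i)) ^ p * ((\<delta> i * y i) * cpoly (pderiv C) (\<alpha> i) ^ p) =
        (cpoly V (\<alpha> i) * cpoly (pderiv C) (\<alpha> i)) ^ p * (cpoly Z (\<alpha> i) * \<alpha> i) ^ p * \<delta> i"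
      by (simp add: y_def power_mult_distrib mult_ac)
    also have "\<dots> = of_int (D ^ p * E ^ p * int c) * (m i ^ p - m i)"
      unfolding D(2)[OF i] E(2)[OF i] by (simp add: \<delta>_def)
    finally have "alg_cong p (of_int (D ^ p * E ^ p * int c) * (m i ^ p - m i)) 0" by simp
    moreover have "coprime (D ^ p * E ^ p * int c) (int p)" using copc copD copE by simp
    ultimately have "alg_cong p (m i ^ p - m i) 0"
      by (rule alg_cong_0_cancel_int) (use m[OF i] in auto)
    hence "alg_cong p (m i ^ p) (m i)" using alg_cong_0_iff_diff by blast
    thus "alg_cong p ((of_int D * l i) ^ p) (of_int D * l i)" by (simp add: m_def)
  qed
qed

text \<open>The numbers \<open>D * l i\<close> share one minimal polynomial \<open>f\<close>. If
  \<open>f\<close> had at most one root \<open>a\<close> modulo a large \<open>p\<close>, Frobenius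
  invariance would make all of them congruent to \<open>a\<close>, which distinct ones are for
  finitely many \<open>p\<close> only. So two different coefficients give \<open>f\<close> two roots
  modulo almost every prime.\<close>

lemma coefficients_equal_if_almost_dold:
  assumes "almost_dold_condition U" "i\<^sub>0 < d" "j\<^sub>0 < d"
  shows "l i\<^sub>0 = l j\<^sub>0"
proof (rule ccontr)
  assume neq: "l i\<^sub>0 \<noteq> l j\<^sub>0"
  hence d2: "d \<ge> 2" using assms(2,3) by (cases "d = 1") auto
  obtain c where c: "c > 0" "dold_condition (\<lambda>n. int c * U n)"
    using assms(1) unfolding almost_dold_condition_def by blast
  obtain H where H: "\<And>i. i < d \<Longrightarrow> l i * cpoly (pderiv C) (\<alpha> i) = cpoly H (\<alpha> i)"
    by (rule coefficients_times_derivative) (rule that)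
  obtain V D where D: "D \<noteq> 0" "\<And>i. i < d \<Longrightarrow> cpoly V (\<alpha> i) * cpoly (pderiv C) (\<alpha> i) = of_int D"
    by (rule integer_multiple[OF derivative_nonzero]) (rule that)
  define h where "h = V * H"
  have h: "of_int D * l i = cpoly h (\<alpha> i)" if "i < d" for i
    using D(2)[OF that] H[OF that] by (simp add: h_def cpoly_mult mult_ac flip: D(2)[OF that] H[OF that])
  obtain w where w: "\<And>p i. prime p \<Longrightarrow> p > w \<Longrightarrow> i < d \<Longrightarrow> alg_cong p ((of_int D * l i) ^ p) (of_int D * l i)"
    by (rule frobenius_fixes_coefficients[OF d2 c D h]) (assumption | rule that)+
  define m where "m = (\<lambda>i. of_int D * l i)"
  have m: "algebraic_int (m i)" if "i < d" for i
    unfolding m_def h[OF that] using algebraic_int_\<alpha>[OF that] by auto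
  have m0: "algebraic_int (m 0)" using m d by simp
  obtain f where f: "lead_coeff f = 1" "degree f \<ge> 1" "cpoly f (m 0) = 0"
    "\<And>g. g \<noteq> 0 \<Longrightarrow> degree g < degree f \<Longrightarrow> cpoly g (m 0) \<noteq> 0"
    by (rule algebraic_int_minimal_poly[OF m0]) (rule that)
  have z: "cpoly (pcompose f h) (\<alpha> 0) = 0" using f(3) h[of 0] d by (simp add: cpoly_pcompose m_def)
  have "cpoly (pcompose f h) (\<alpha> i) = 0" if "i < d" for i
    by (rule conjugate[OF _ that z]) (use d in simp)
  hence fm: "cpoly f (m i) = 0" if "i < d" for i using h that by (simp add: cpoly_pcompose m_def)
  have "degree f \<noteq> 1"
  proof
    assume "degree f = 1"
    then obtain b a where ba: "f = [:b, a:]" by (metis degree1_coeffs)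
    hence "a = 1" using f(1,2) by (cases "a = 0") auto
    hence "m i = - of_int b" if "i < d" for i using fm[OF that] ba by (simp add: cpoly_pCons add_eq_0_iff)
    hence "m i\<^sub>0 = m j\<^sub>0" using assms by simp
    thus False using neq D(1) by (simp add: m_def)
  qed
  hence k: "degree f \<ge> 2" using f(2) by simp
  have "algebraic_int (m i\<^sub>0 - m j\<^sub>0)" "m i\<^sub>0 - m j\<^sub>0 \<noteq> 0" using m assms neq D(1) by (auto simp: m_def)
  \<comment> \<open>A prime dividing \<open>m i\<^sub>0 - m j\<^sub>0\<close> divides the nonzero
    integer \<open>M\<close>, hence is bounded.\<close>
  then obtain s M where M: "M \<noteq> 0" "(m i\<^sub>0 - m j\<^sub>0) * cpoly s (m i\<^sub>0 - m j\<^sub>0) = of_int M"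
    by (rule algebraic_int_integer_multiple)
  show False
  proof (rule not_two_roots_mod_almost_all_primes[OF f(1) refl k f(3,4)])
    fix p :: nat assume p: "prime p" "p > w + nat \<bar>M\<bar>"
    show "\<exists>a b. int p dvd poly f a \<and> int p dvd poly f b \<and> \<not> int p dvd a - b"
    proof (rule ccontr)
      assume not_two: "\<not> ?thesis"
      \<comment> \<open>If \<open>f\<close> has no root modulo \<open>p\<close>, any
        \<open>a\<close> satisfies this vacuously.\<close>
      obtain a where a: "\<And>b. int p dvd poly f b \<Longrightarrow> int p dvd b - a"
      proof (cases "\<exists>a. int p dvd poly f a")
        case True
        then obtain a where "int p dvd poly f a" by blast
        thus ?thesis using not_two that[of a] by blast
      qed (use that in blast)
      have "alg_cong p (m i) (of_int a)" if "i < d" for i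
        using p a by (intro frobenius_fixed_single_root[of p "m i" f] m fm that)
                     (auto simp: m_def intro: w[OF _ _ that])
      hence "alg_cong p (m i\<^sub>0) (of_int a)" "alg_cong p (of_int a) (m j\<^sub>0)"
        using assms alg_cong_sym by auto
      hence "alg_cong p (m i\<^sub>0) (m j\<^sub>0)" by (rule alg_cong_trans)
      hence "alg_cong p (m i\<^sub>0 - m j\<^sub>0) 0" using alg_cong_0_iff_diff by blast
      hence "alg_cong p (cpoly s (m i\<^sub>0 - m j\<^sub>0) * (m i\<^sub>0 - m j\<^sub>0)) (cpoly s (m i\<^sub>0 - m j\<^sub>0) * 0)"
        by (rule alg_cong_mult_left[rotated]) (use m assms in auto)
      hence "alg_cong p (of_int M) 0" using M(2) by (simp add: mult.commute)
      hence "int p dvd M" using p by (intro alg_cong_of_intD) auto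
      thus False using dvd_imp_le_int[OF M(1), of "int p"] p(2) by auto
    qed
  qed
qed

text \<open>Evaluation at 0 gives \<open>d * l 0 = U 0\<close>, so multiplying by \<open>d\<close>
  turns \<open>U n\<close> into an integer multiple of the power sum.\<close>

lemma almost_dold_if_coefficients_equal:
  assumes eq: "\<forall>i<d. \<forall>j<d. l i = l j"
  shows "almost_dold_condition U"
  unfolding almost_dold_condition_def
proof (intro exI conjI)
  show "d > 0" using d by simp
  have l: "l i = l 0" if "i < d" for i
    by (rule eq[rule_format, OF that]) (use d in simp)
  have U': "complex_of_int (U n) = l 0 * (\<Sum>i<d. \<alpha> i ^ n)" for n
    unfolding U sum_distrib_left by (intro sum.cong refl arg_cong2[of _ _ _ _ "(*)"] l) simp
  have U0: "complex_of_int (U 0) = of_nat d * l 0" using U'[of 0] by (simp add: mult.commute)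
  show "dold_condition (\<lambda>n. int d * U n)"
    by (rule power_sums_dold[OF monic_C C_eq, of _ "U 0"]) (simp_all add: U' U0)
qed

end

theorem theorem6:
  fixes d :: nat and r U :: "nat \<Rightarrow> int" and \<alpha> l :: "nat \<Rightarrow> complex"
  assumes "d \<ge> 1"
    and "\<And>n. n \<ge> d \<Longrightarrow> U n = (\<Sum>i=1..d. r i * U (n - i))"
    and "irreducible (map_poly rat_of_int (rec_char_poly d r))"
    and "map_poly complex_of_int (rec_char_poly d r) = (\<Prod>i<d. [:- \<alpha> i, 1:])"
    and "\<And>n. complex_of_int (U n) = (\<Sum>i<d. l i * \<alpha> i ^ n)"
  shows "almost_dold_condition U \<longleftrightarrow> (\<forall>i<d. \<forall>j<d. l i = l j)"
proof -
  interpret irreducible_recurrence d "rec_char_poly d r" U \<alpha> l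
    by unfold_locales (use assms in auto)
  show ?thesis
    using coefficients_equal_if_almost_dold almost_dold_if_coefficients_equal by blast
qed

end
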